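(* Let $(N,M,\mathcal V,G)$ be an instance of fair division with conflict graph $G=(M,E)$, with $n$ agents and $m$ goods, in which all agents have the same additive valuation function $v:2^M\to\mathbb R_{\ge 0}$. Then the algorithm \textsc{CyclicShiftRR} (described in the context) computes a complete, balanced EF1 allocation with at most $|E|/n$ violations, in $O(m\log m+|E|)$ time.
   Context: Setting. $N=\{1,\dots,n\}$ is the set of agents and $M=\{1,\dots,m\}$ the set of indivisible goods. Each agent $i$ has a valuation $v_i:2^M\to\mathbb R_{\ge0}$, assumed additive: $v_i(S)=\sum_{g\in S}v_i(\{g\})$. The valuations are identical if all $v_i$ equal a common $v$. An allocation is $\mathcal A=(A_1,\dots,A_n)$ with pairwise disjoint bundles $A_i\subseteq M$; it is complete if $A_1\cup\dots\cup A_n=M$. It is EF1 (envy-free up to one good) if for all $i\ne j$ in $N$, either $A_j=\emptyset$ or there is $g\in A_j$ with $v_i(A_i)\ge v_i(A_j\setminus\{g\})$. It is balanced if $\bigl||A_i|-|A_j|\bigr|\le 1$ for all $i,j$. The conflict graph $G=(M,E)$ is a simple undirected graph on the goods; an edge $\{u,w\}\in E$ is violated by $\mathcal A$ if $\{u,w\}\subseteq A_i$ for some $i$, and the number of violations is the number of violated edges. Algorithm \textsc{CyclicShiftRR}. Sort and relabel the goods so that $v(\{1\})\ge\dots\ge v(\{m\})$. If $m$ is not divisible by $n$, append at the end of the order the minimum number of dummy goods (value $0$, no conflicts) making the number of goods divisible by $n$; they are removed from the final output. Below, $m$ denotes the padded number of goods. Start with $\mathcal A=(\emptyset,\dots,\emptyset)$.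 For $i=1,\dots,m/n$: for each $s=1,\dots,n$ let $c=(c_1,\dots,c_n)=((i-1)n+s,\dots,(i-1)n+n,(i-1)n+1,\dots,(i-1)n+s-1)$ and $\mathcal A^{(s)}=(A_1\cup\{c_1\},\dots,A_n\cup\{c_n\})$; then replace $\mathcal A$ by an allocation with the minimum number of violations among $\mathcal A^{(1)},\dots,\mathcal A^{(n)}$. Return $\mathcal A$. Running time counts elementary operations, with arithmetic and comparison of valuations at unit cost; in the time bound $m$ is the number of goods of the instance. *)

theory Defs
  imports Complex_Main
begin

definition agents :: "nat \<Rightarrow> nat set" where
  "agents n = {1..n}"

definition goods :: "nat \<Rightarrow> nat set" where
  "goods m = {1..m}"

definition simple_graph_on :: "nat set \<Rightarrow> nat set set \<Rightarrow> bool" where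
  "simple_graph_on M E \<longleftrightarrow> (\<forall>e\<in>E. e \<subseteq> M \<and> card e = 2)"

definition additive_valuation :: "nat set \<Rightarrow> (nat set \<Rightarrow> real) \<Rightarrow> bool" where
  "additive_valuation M f \<longleftrightarrow>
     (\<forall>S. S \<subseteq> M \<longrightarrow> 0 \<le> f S \<and> f S = (\<Sum>g\<in>S. f {g}))"

definition fd_instance ::
  "nat \<Rightarrow> nat \<Rightarrow> (nat \<Rightarrow> nat set \<Rightarrow> real) \<Rightarrow> nat set set \<Rightarrow> bool" where
  "fd_instance n m V E \<longleftrightarrow>
     1 \<le> n \<and> (\<forall>i\<in>agents n. additive_valuation (goods m) (V i)) \<and> simple_graph_on (goods m) E"

definition identical_valuations ::
  "nat \<Rightarrow> nat \<Rightarrow> (nat \<Rightarrow> nat set \<Rightarrow> real) \<Rightarrow> (nat set \<Rightarrow> real) \<Rightarrow> bool" where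
  "identical_valuations n m V v \<longleftrightarrow> (\<forall>i\<in>agents n. \<forall>S. S \<subseteq> goods m \<longrightarrow> V i S = v S)"

text \<open>Bundles are given by a function on the naturals, of which only the values on
  \<^term>\<open>agents n\<close> are meaningful.\<close>

definition allocation :: "nat \<Rightarrow> nat \<Rightarrow> (nat \<Rightarrow> nat set) \<Rightarrow> bool" where
  "allocation n m A \<longleftrightarrow>
     (\<forall>i\<in>agents n. A i \<subseteq> goods m) \<and>
     (\<forall>i\<in>agents n. \<forall>j\<in>agents n. i \<noteq> j \<longrightarrow> A i \<inter> A j = {})"

definition complete_alloc :: "nat \<Rightarrow> nat \<Rightarrow> (nat \<Rightarrow> nat set) \<Rightarrow> bool" where
  "complete_alloc n m A \<longleftrightarrow> (\<Union>i\<in>agents n. A i) = goods m"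

definition EF1 :: "nat \<Rightarrow> (nat \<Rightarrow> nat set \<Rightarrow> real) \<Rightarrow> (nat \<Rightarrow> nat set) \<Rightarrow> bool" where
  "EF1 n V A \<longleftrightarrow>
     (\<forall>i\<in>agents n. \<forall>j\<in>agents n. i \<noteq> j \<longrightarrow>
        A j = {} \<or> (\<exists>g\<in>A j. V i (A i) \<ge> V i (A j - {g})))"

definition balanced :: "nat \<Rightarrow> (nat \<Rightarrow> nat set) \<Rightarrow> bool" where
  "balanced n A \<longleftrightarrow>
     (\<forall>i\<in>agents n. \<forall>j\<in>agents n. \<bar>int (card (A i)) - int (card (A j))\<bar> \<le> 1)"

definition violations :: "nat \<Rightarrow> nat set set \<Rightarrow> (nat \<Rightarrow> nat set) \<Rightarrow> nat" where
  "violations n E A = card {e \<in> E. \<exists>i\<in>agents n. e \<subseteq> A i}"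

text \<open>The algorithm leaves the order of goods of equal value and the choice among allocations
  with the same number of violations open. It is therefore described by the set of its possible
  outputs. The list \<open>L\<close> holds the goods in sorted order: the good relabelled \<open>k\<close> is
  \<open>L ! (k - 1)\<close>.\<close>

definition sorted_goods :: "nat \<Rightarrow> (nat set \<Rightarrow> real) \<Rightarrow> nat list \<Rightarrow> bool" where
  "sorted_goods m v L \<longleftrightarrow>
     distinct L \<and> set L = goods m \<and> sorted_wrt (\<lambda>g h. v {g} \<ge> v {h}) L"

definition padded_size :: "nat \<Rightarrow> nat \<Rightarrow> nat" where
  "padded_size n m = (LEAST k. m \<le> k \<and> n dvd k)"

text \<open>The dummy goods are the numbers above \<open>m\<close>. They lie outside the conflict graph, and they
  are never inspected for their value.\<close>

definition pad_goods :: "nat \<Rightarrow> nat \<Rightarrow> nat list \<Rightarrow> nat list" where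
  "pad_goods n m L = L @ [Suc m..<Suc (padded_size n m)]"

text \<open>The tuple \<open>c\<close> of the shift \<open>s\<close> in round \<open>i\<close> (both counted from 1), and the allocation
  \<open>A\<close> extended by it.\<close>

definition shift_tuple :: "nat \<Rightarrow> nat list \<Rightarrow> nat \<Rightarrow> nat \<Rightarrow> nat list" where
  "shift_tuple n L i s = rotate (s - 1) (take n (drop ((i - 1) * n) L))"

definition add_tuple :: "nat \<Rightarrow> nat list \<Rightarrow> (nat \<Rightarrow> nat set) \<Rightarrow> nat \<Rightarrow> nat set" where
  "add_tuple n c A = (\<lambda>a. if a \<in> agents n then A a \<union> {c ! (a - 1)} else A a)"

inductive csrr_rounds ::
  "nat \<Rightarrow> nat set set \<Rightarrow> nat list \<Rightarrow> nat \<Rightarrow> (nat \<Rightarrow> nat set) \<Rightarrow> bool"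
  for n E L where
  start: "csrr_rounds n E L 0 (\<lambda>_. {})"
| round: "csrr_rounds n E L (Suc i) (add_tuple n (shift_tuple n L (Suc i) s) A)"
    if "csrr_rounds n E L i A"
      and "s \<in> {1..n}"
      and "\<forall>t\<in>{1..n}. violations n E (add_tuple n (shift_tuple n L (Suc i) s) A)
                     \<le> violations n E (add_tuple n (shift_tuple n L (Suc i) t) A)"

definition cyclic_shift_rr ::
  "nat \<Rightarrow> nat \<Rightarrow> (nat set \<Rightarrow> real) \<Rightarrow> nat set set \<Rightarrow> (nat \<Rightarrow> nat set) \<Rightarrow> bool" where
  "cyclic_shift_rr n m v E A \<longleftrightarrow>
     (\<exists>L B. sorted_goods m v L \<and>
            csrr_rounds n E (pad_goods n m L) (padded_size n m div n) B \<and>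
            A = (\<lambda>a. B a \<inter> goods m))"

text \<open>Programs use registers and arrays that hold natural numbers; their names are natural
  numbers too. Natural numbers can be added and subtracted (truncating at 0). The values of
  single goods are available only through comparisons. All nodes of an expression and all
  executed commands cost one unit. There is no multiplication, no division and no arithmetic
  on values, which only restricts the programs.\<close>

datatype aexp =
    Num nat
  | Reg nat
  | Read nat aexp  \<comment> \<open>array and index\<close>
  | Add aexp aexp
  | Sub aexp aexp

datatype bexp =
    Less aexp aexp
  | LessVal aexp aexp  \<comment> \<open>compares the values of two goods\<close>
  | Not bexp
  | And bexp bexp

datatype com =
    Skip
  | Assign nat aexp
  | Store nat aexp aexp  \<comment> \<open>array, index and new entry\<close>
  | Seq com com
  | If bexp com com
  | While bexp com

record state =
  reg :: "nat \<Rightarrow> nat"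
  arr :: "nat \<Rightarrow> nat \<Rightarrow> nat"

fun aval :: "aexp \<Rightarrow> state \<Rightarrow> nat" where
  "aval (Num k) \<sigma> = k"
| "aval (Reg x) \<sigma> = reg \<sigma> x"
| "aval (Read r e) \<sigma> = arr \<sigma> r (aval e \<sigma>)"
| "aval (Add e f) \<sigma> = aval e \<sigma> + aval f \<sigma>"
| "aval (Sub e f) \<sigma> = aval e \<sigma> - aval f \<sigma>"

fun acost :: "aexp \<Rightarrow> nat" where
  "acost (Num k) = 1"
| "acost (Reg x) = 1"
| "acost (Read r e) = acost e + 1"
| "acost (Add e f) = acost e + acost f + 1"
| "acost (Sub e f) = acost e + acost f + 1"

fun bval :: "(nat \<Rightarrow> real) \<Rightarrow> bexp \<Rightarrow> state \<Rightarrow> bool" where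
  "bval w (Less e f) \<sigma> \<longleftrightarrow> aval e \<sigma> < aval f \<sigma>"
| "bval w (LessVal e f) \<sigma> \<longleftrightarrow> w (aval e \<sigma>) < w (aval f \<sigma>)"
| "bval w (Not b) \<sigma> \<longleftrightarrow> \<not> bval w b \<sigma>"
| "bval w (And b c) \<sigma> \<longleftrightarrow> bval w b \<sigma> \<and> bval w c \<sigma>"

fun bcost :: "bexp \<Rightarrow> nat" where
  "bcost (Less e f) = acost e + acost f + 1"
| "bcost (LessVal e f) = acost e + acost f + 1"
| "bcost (Not b) = bcost b + 1"
| "bcost (And b c) = bcost b + bcost c + 1"

text \<open>\<open>exec w p \<sigma> t \<tau>\<close>: with values \<open>w\<close> of the single goods, the program \<open>p\<close> started in
  \<open>\<sigma>\<close> terminates in \<open>\<tau>\<close> at total cost \<open>t\<close>.\<close>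

inductive exec :: "(nat \<Rightarrow> real) \<Rightarrow> com \<Rightarrow> state \<Rightarrow> nat \<Rightarrow> state \<Rightarrow> bool"
  for w where
  Skip: "exec w Skip \<sigma> 1 \<sigma>"
| Assign: "exec w (Assign x e) \<sigma> (acost e + 1) (\<sigma>\<lparr>reg := (reg \<sigma>)(x := aval e \<sigma>)\<rparr>)"
| Store: "exec w (Store r e f) \<sigma> (acost e + acost f + 1)
            (\<sigma>\<lparr>arr := (arr \<sigma>)(r := (arr \<sigma> r)(aval e \<sigma> := aval f \<sigma>))\<rparr>)"
| Seq: "exec w (Seq c d) \<sigma> (t + u + 1) \<upsilon>"
    if "exec w c \<sigma> t \<tau>" and "exec w d \<tau> u \<upsilon>"
| IfTrue: "exec w (If b c d) \<sigma> (bcost b + t + 1) \<tau>"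
    if "bval w b \<sigma>" and "exec w c \<sigma> t \<tau>"
| IfFalse: "exec w (If b c d) \<sigma> (bcost b + t + 1) \<tau>"
    if "\<not> bval w b \<sigma>" and "exec w d \<sigma> t \<tau>"
| WhileFalse: "exec w (While b c) \<sigma> (bcost b + 1) \<sigma>"
    if "\<not> bval w b \<sigma>"
| WhileTrue: "exec w (While b c) \<sigma> (bcost b + t + u + 1) \<upsilon>"
    if "bval w b \<sigma>" and "exec w c \<sigma> t \<tau>" and "exec w (While b c) \<tau> u \<upsilon>"

text \<open>The conflict graph is passed as a list that has every edge exactly once, in any order and
  orientation.\<close>

definition edge_list :: "nat set set \<Rightarrow> (nat \<times> nat) list \<Rightarrow> bool" where
  "edge_list E es \<longleftrightarrow>
     distinct (map (\<lambda>(x, y). {x, y}) es) \<and> set (map (\<lambda>(x, y). {x, y}) es) = E"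

text \<open>Registers 0, 1, 2 hold the numbers of agents, goods and edges, arrays 0 and 1 the two
  endpoints of each edge; the rest of the memory is zero.\<close>

definition input_state :: "nat \<Rightarrow> nat \<Rightarrow> (nat \<times> nat) list \<Rightarrow> state" where
  "input_state n m es =
     \<lparr>reg = (\<lambda>_. 0)(0 := n, 1 := m, 2 := length es),
      arr = (\<lambda>_ _. 0)
        (0 := (\<lambda>k. if k < length es then fst (es ! k) else 0),
         1 := (\<lambda>k. if k < length es then snd (es ! k) else 0))\<rparr>"

text \<open>The result is left in array 2, which holds the owner of every good.\<close>

definition output_alloc :: "nat \<Rightarrow> state \<Rightarrow> nat \<Rightarrow> nat set" where
  "output_alloc m \<sigma> = (\<lambda>a. {g \<in> goods m. arr \<sigma> 2 g = a})"

definition computes_in ::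
  "com \<Rightarrow> nat \<Rightarrow> nat \<Rightarrow> (nat set \<Rightarrow> real) \<Rightarrow> (nat \<times> nat) list \<Rightarrow> nat \<Rightarrow> (nat \<Rightarrow> nat set) \<Rightarrow> bool"
  where
  "computes_in p n m v es t A \<longleftrightarrow>
     (\<exists>\<sigma>. exec (\<lambda>g. v {g}) p (input_state n m es) t \<sigma> \<and> A = output_alloc m \<sigma>)"

end

theory Submission
  imports Defs "HOL-Number_Theory.Cong"
begin

text \<open>In a round every agent receives one good of the current row of \<open>n\<close> goods. For an edge from
  an earlier row into the current row there is exactly one cyclic shift that gives both ends to
  the same agent, and edges inside the row are never violated. The best shift therefore adds at
  most \<open>1/n\<close> of the edges that become relevant in this round. EF1 holds because every good of
  row \<open>r + 1\<close> is worth at most as much as every good of row \<open>r\<close>.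

  For the running time, the goods are sorted by bottom-up merge sort, and each edge is put on a
  linked list that belongs to the row of its later end. A round walks through its list and counts
  for each shift the edges violated by it, takes a shift with the smallest count, and hands out
  the row. In the first row all shifts are equally good, so no loop over the agents is needed; this
  matters if \<open>n > m\<close>. Each later round costs \<open>O(n)\<close> plus the length of its list, and the number of
  later rounds is less than \<open>m / n\<close>.\<close>

subsection \<open>Rows and shifts\<close>

text \<open>The algorithm is a relation, since ties are left open, so the argument has two
  independent halves: every output of the relation has the claimed properties, and one fixed program
  always ends in some output of it. The invariant of the program therefore carries an existentially
  quantified allocation that the algorithm can reach. Completeness, balance and EF1 hold for
  arbitrary shifts in the rows, which is why a closed form with a free shift per row replaces the
  run in those arguments; minimality enters through the count of violations. The machine neither
  multiplies nor divides. Rows and columns are counted along the sorted order, the padded size is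
  never computed, and dummies are never stored: the last row simply stops at \<open>m\<close>. The
  constants in the cost bounds are round numbers above the syntactic cost of loop bodies.\<close>

lemma padded_size_properties:
  assumes "1 \<le> n"
  shows "m \<le> padded_size n m" "n dvd padded_size n m" "padded_size n m < m + n"
proof -
  let ?P = "\<lambda>k. m \<le> k \<and> n dvd k"
  have "?P (m * n)" using assms by simp
  then have P: "?P (padded_size n m)"
    unfolding padded_size_def by (rule LeastI)
  then show "m \<le> padded_size n m" "n dvd padded_size n m" by auto
  show "padded_size n m < m + n"
  proof (rule ccontr)
    assume "\<not> padded_size n m < m + n"
    then have "?P (padded_size n m - n)" using P by (auto intro: dvd_diff_nat)
    then have "padded_size n m \<le> padded_size n m - n"
      unfolding padded_size_def by (rule Least_le)
    with assms P \<open>\<not> padded_size n m < m + n\<close> show False by linarith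
  qed
qed

text \<open>Between \<open>m\<close> and \<open>m + n\<close>, the latter excluded, there is only
  one multiple of \<open>n\<close>. This identifies the padded size from the position at which the
  round loop stops.\<close>

lemma padded_size_unique:
  assumes "1 \<le> n" "m \<le> k" "n dvd k" "k < m + n"
  shows "padded_size n m = k"
proof -
  note p = padded_size_properties[OF assms(1), of m]
  obtain x y where x: "padded_size n m = n * x" and y: "k = n * y"
    using p(2) assms(3) unfolding dvd_def by blast
  have "n * x < n * (y + 1)" "n * y < n * (x + 1)"
    using p assms x y by (simp_all add: algebra_simps)
  then have "x < y + 1" "y < x + 1" by (metis mult_less_cancel1)+
  with x y show ?thesis by simp
qed

text \<open>The sum wraps around at most once, so the shift can be solved for by a case distinction
  and a subtraction. This is the form in which the program computes it.\<close>

lemma add_mod_eq_iff: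
  fixes n s a q :: nat
  assumes "s < n" "a < n" "q < n"
  shows "(s + a) mod n = q \<longleftrightarrow> s = (if a \<le> q then q - a else q + n - a)"
proof -
  have "(s + a) mod n = (if s + a < n then s + a else s + a - n)"
    using assms by (simp add: mod_if)
  then show ?thesis using assms by auto
qed

lemma add_mod_cancel_right:
  fixes n s t a :: nat
  assumes "s < n" "t < n" "(s + a) mod n = (t + a) mod n"
  shows "s = t"
proof -
  have "[s = t] (mod n)"
    using assms(3) by (simp add: cong_def[symmetric] cong_add_rcancel_nat)
  then show ?thesis using assms by (simp add: cong_def)
qed

lemma row_index_eq_iff:
  fixes n :: nat
  assumes "q < n" "q' < n"
  shows "r * n + q = r' * n + q' \<longleftrightarrow> r = r' \<and> q = q'"
proof
  assume "r * n + q = r' * n + q'"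
  then have "(r * n + q) div n = (r' * n + q') div n" "(r * n + q) mod n = (r' * n + q') mod n"
    by simp_all
  then show "r = r' \<and> q = q'" using assms by simp
qed simp

lemma row_index_less:
  fixes n :: nat
  assumes "r < i" "q < n"
  shows "r * n + q < i * n"
proof -
  have "r * n + q < Suc r * n" using assms by simp
  also have "\<dots> \<le> i * n" using assms by (intro mult_le_mono1) simp
  finally show ?thesis .
qed

lemma nth_in_set_take_iff:
  assumes "distinct L" "j < length L"
  shows "L ! j \<in> set (take k L) \<longleftrightarrow> j < k"
  using assms by (auto simp: in_set_conv_nth nth_eq_iff_index_eq)

lemma nth_row:
  assumes "distinct L" "Suc i * n \<le> length L" "q < n"
  shows "L ! (i * n + q) \<in> set (take (Suc i * n) L)" "L ! (i * n + q) \<notin> set (take (i * n) L)"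
  using assms by (subst nth_in_set_take_iff; simp)+

text \<open>In row \<open>r\<close> the shift \<open>s r\<close> was chosen, counted from 0.\<close>

definition row_alloc :: "nat \<Rightarrow> nat list \<Rightarrow> (nat \<Rightarrow> nat) \<Rightarrow> nat \<Rightarrow> nat \<Rightarrow> nat set" where
  "row_alloc n L s i a =
     (if a \<in> agents n then (\<lambda>r. L ! (r * n + (s r + (a - 1)) mod n)) ` {..<i} else {})"

lemma nth_shift_tuple:
  assumes "a \<in> agents n" "Suc i * n \<le> length L"
  shows "shift_tuple n L (Suc i) s ! (a - 1) = L ! (i * n + (s - 1 + (a - 1)) mod n)"
proof -
  have len: "length (take n (drop (i * n) L)) = n" using assms(2) by simp
  moreover have "a - 1 < n" using assms(1) by (auto simp: agents_def)
  ultimately show ?thesis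
    using assms(2) by (simp add: shift_tuple_def nth_rotate)
qed

lemma add_tuple_shift_tuple:
  assumes "Suc i * n \<le> length L"
  shows "add_tuple n (shift_tuple n L (Suc i) s) A =
    (\<lambda>a. if a \<in> agents n then A a \<union> {L ! (i * n + (s - 1 + (a - 1)) mod n)} else A a)"
  unfolding add_tuple_def using nth_shift_tuple[OF _ assms] by (intro ext) auto

text \<open>A run only ever deals out each row by some shift. What is proved for
  \<open>row_alloc\<close> with a free \<open>s\<close> thus covers every way of resolving
  ties.\<close>

lemma csrr_rounds_row_alloc:
  assumes "csrr_rounds n E L i A" "i * n \<le> length L"
  shows "\<exists>s. A = row_alloc n L s i"
  using assms
proof induction
  case start
  show ?case by (intro exI[of _ "\<lambda>_. 0"] ext) (simp add: row_alloc_def)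
next
  case (round i A t)
  then obtain s where s: "A = row_alloc n L s i" by auto
  have "add_tuple n (shift_tuple n L (Suc i) t) A = row_alloc n L (s(i := t - 1)) (Suc i)"
    unfolding add_tuple_shift_tuple[OF round.prems] s
    by (rule ext) (auto simp: row_alloc_def lessThan_Suc)
  then show ?case by blast
qed

lemma row_alloc_subset:
  assumes "distinct L" "i * n \<le> length L"
  shows "row_alloc n L s i a \<subseteq> set (take (i * n) L)"
proof (cases "a \<in> agents n")
  case True
  then have "r * n + (s r + (a - 1)) mod n < i * n" if "r < i" for r
    using row_index_less[OF that] by (simp add: agents_def)
  then have "L ! (r * n + (s r + (a - 1)) mod n) \<in> set (take (i * n) L)" if "r < i" for r
    using that assms by (subst nth_in_set_take_iff) (auto intro: less_le_trans)
  with True show ?thesis unfolding row_alloc_def by auto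
qed (simp add: row_alloc_def)

lemma row_alloc_disjoint:
  assumes "distinct L" "i * n \<le> length L" "a \<noteq> b"
  shows "row_alloc n L s i a \<inter> row_alloc n L s i b = {}"
proof (cases "a \<in> agents n \<and> b \<in> agents n")
  case True
  then have n: "0 < n" by (auto simp: agents_def)
  have False if "r < i" "r' < i"
    and eq: "L ! (r * n + (s r + (a - 1)) mod n) = L ! (r' * n + (s r' + (b - 1)) mod n)" for r r'
  proof -
    have "r * n + (s r + (a - 1)) mod n = r' * n + (s r' + (b - 1)) mod n"
      using eq row_index_less[of r i _ n] row_index_less[of r' i _ n] that n assms
      by (metis mod_less_divisor nth_eq_iff_index_eq order_less_le_trans)
    then have "r = r'" "(s r + (a - 1)) mod n = (s r + (b - 1)) mod n"
      using row_index_eq_iff n by auto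
    then have "a - 1 = b - 1"
      using add_mod_cancel_right[of "a - 1" n "b - 1" "s r"] True
      by (auto simp: agents_def add.commute)
    then show False using True assms(3) by (auto simp: agents_def)
  qed
  then show ?thesis by (auto simp: row_alloc_def)
qed (auto simp: row_alloc_def)

subsection \<open>Violations\<close>

text \<open>Here the shift is counted from 0, whereas \<open>shift_tuple\<close> counts it from 1;
  hence the \<open>t - 1\<close> and \<open>Suc s\<close> where both meet.\<close>

definition new_violations ::
  "nat \<Rightarrow> nat set set \<Rightarrow> nat list \<Rightarrow> nat \<Rightarrow> (nat \<Rightarrow> nat set) \<Rightarrow> nat \<Rightarrow> nat set set" where
  "new_violations n E L i A s =
     {e \<in> E. \<exists>a\<in>agents n. \<exists>x\<in>A a. e = {x, L ! (i * n + (s + (a - 1)) mod n)}}"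

text \<open>A bundle gains one good, and that good lies outside the earlier rows. An edge that
  becomes violated therefore has exactly one new end, and it was not violated before.\<close>

lemma violations_add_tuple:
  assumes E: "finite E" "\<forall>e\<in>E. card e = 2"
    and L: "distinct L" "Suc i * n \<le> length L"
    and A: "\<And>a. A a \<subseteq> set (take (i * n) L)"
  shows "violations n E (add_tuple n (shift_tuple n L (Suc i) t) A) =
    violations n E A + card (new_violations n E L i A (t - 1))"
proof -
  define c where "c a = L ! (i * n + (t - 1 + (a - 1)) mod n)" for a
  have c: "c a \<notin> set (take (i * n) L)" if "a \<in> agents n" for a
    unfolding c_def using that L by (intro nth_row) (simp_all add: agents_def)
  have "{e \<in> E. \<exists>a\<in>agents n. e \<subseteq> A a \<union> {c a}} =
    {e \<in> E. \<exists>a\<in>agents n. e \<subseteq> A a} \<union> new_violations n E L i A (t - 1)" (is "?U = ?V \<union> ?W")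
  proof
    show "?U \<subseteq> ?V \<union> ?W"
    proof
      fix e assume "e \<in> ?U"
      then obtain a where a: "a \<in> agents n" "e \<subseteq> A a \<union> {c a}" "e \<in> E" by auto
      show "e \<in> ?V \<union> ?W"
      proof (cases "e \<subseteq> A a")
        case False
        then have "c a \<in> e" using a by auto
        moreover obtain u w where "e = {u, w}" "u \<noteq> w"
          using E(2) a(3) by (auto simp: card_2_iff)
        ultimately obtain x where "e = {x, c a}" "x \<noteq> c a" by auto
        then show ?thesis using a by (auto simp: new_violations_def c_def)
      qed (use a in auto)
    qed
    show "?V \<union> ?W \<subseteq> ?U" by (auto simp: new_violations_def c_def)
  qed
  moreover have "?V \<inter> ?W = {}"
    using A c by (auto simp: new_violations_def c_def)
  ultimately have "card ?U = card ?V + card ?W"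
    using E(1) by (simp add: card_Un_disjoint new_violations_def)
  moreover have "violations n E (add_tuple n (shift_tuple n L (Suc i) t) A) = card ?U"
    unfolding violations_def add_tuple_shift_tuple[OF L(2)] c_def
    by (intro arg_cong[where f = card] Collect_cong conj_cong bex_cong) simp_all
  ultimately show ?thesis by (simp add: violations_def)
qed

text \<open>Double counting. The earlier end of an edge has a fixed owner, and only one shift gives
  the later end to that owner, so the sets for different shifts are disjoint. Their union lies among
  the edges completed by row \<open>i\<close>.\<close>

lemma sum_new_violations_le:
  assumes E: "finite E"
    and L: "distinct L" "Suc i * n \<le> length L"
    and A: "\<And>a. A a \<subseteq> set (take (i * n) L)"
      "\<And>a b. a \<noteq> b \<Longrightarrow> A a \<inter> A b = {}"
  shows "(\<Sum>s<n. card (new_violations n E L i A s)) \<le>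
    card {e \<in> E. e \<subseteq> set (take (Suc i * n) L) \<and> \<not> e \<subseteq> set (take (i * n) L)}"
proof -
  have idx: "i * n \<le> i * n + (s + (a - 1)) mod n \<and> i * n + (s + (a - 1)) mod n < Suc i * n"
    if "a \<in> agents n" for s a
    using that row_index_less[of i "Suc i" _ n] by (auto simp: agents_def)
  have new: "L ! (i * n + (s + (a - 1)) mod n) \<in> set (take (Suc i * n) L)"
    and old: "L ! (i * n + (s + (a - 1)) mod n) \<notin> set (take (i * n) L)"
    if "a \<in> agents n" for s a
    using nth_row[OF L, of "(s + (a - 1)) mod n"] that by (auto simp: agents_def)
  have disj: "new_violations n E L i A s \<inter> new_violations n E L i A t = {}"
    if st: "s < n" "t < n" "s \<noteq> t" for s t
  proof -
    have False if a: "a \<in> agents n" "x \<in> A a" and b: "b \<in> agents n" "y \<in> A b"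
      and eq: "{x, L ! (i * n + (s + (a - 1)) mod n)} = {y, L ! (i * n + (t + (b - 1)) mod n)}"
      for a b x y
    proof -
      \<comment> \<open>Of the two ends only one lies in an earlier row, so the two descriptions of
        the edge agree end by end and not crosswise.\<close>
      have "x = y" and c: "L ! (i * n + (s + (a - 1)) mod n) = L ! (i * n + (t + (b - 1)) mod n)"
        using eq a b A(1) old by (auto simp: doubleton_eq_iff) 
      then have "a = b" using a b A(2) by blast
      moreover have "i * n + (s + (a - 1)) mod n < length L" "i * n + (t + (a - 1)) mod n < length L"
        using idx[OF a(1)] L(2) by (meson less_le_trans)+
      ultimately have "i * n + (s + (a - 1)) mod n = i * n + (t + (a - 1)) mod n"
        using c L(1) by (metis nth_eq_iff_index_eq)
      then have "(s + (a - 1)) mod n = (t + (a - 1)) mod n" by linarith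
      then show False using add_mod_cancel_right st by blast
    qed
    then show ?thesis unfolding new_violations_def by blast
  qed
  have "(\<Sum>s<n. card (new_violations n E L i A s)) = card (\<Union>s<n. new_violations n E L i A s)"
    using E disj by (intro card_UN_disjoint[symmetric]) (auto simp: new_violations_def)
  also have "\<dots> \<le> card {e \<in> E. e \<subseteq> set (take (Suc i * n) L) \<and> \<not> e \<subseteq> set (take (i * n) L)}"
  proof (rule card_mono)
    have "set (take (i * n) L) \<subseteq> set (take (Suc i * n) L)"
      by (rule set_take_subset_set_take) simp
    then show "(\<Union>s<n. new_violations n E L i A s) \<subseteq>
      {e \<in> E. e \<subseteq> set (take (Suc i * n) L) \<and> \<not> e \<subseteq> set (take (i * n) L)}"
      using A(1) new old by (fastforce simp: new_violations_def)
  qed (use E in simp)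
  finally show ?thesis .
qed

text \<open>The minimum over \<open>n\<close> shifts is at most their average. Charging each round
  only with the edges completed in it makes the rounds add up without overlap, and multiplying by
  \<open>n\<close> keeps the induction in the natural numbers.\<close>

lemma csrr_rounds_violations_le:
  assumes "csrr_rounds n E L i A" "i * n \<le> length L"
    and E: "finite E" "\<forall>e\<in>E. card e = 2" and L: "distinct L"
  shows "n * violations n E A \<le> card {e \<in> E. e \<subseteq> set (take (i * n) L)}"
  using assms(1,2)
proof induction
  case start
  have "{e \<in> E. \<exists>i\<in>agents n. e \<subseteq> {}} = {}" using E(2) by auto
  then show ?case unfolding violations_def by (simp only: card.empty mult_0_right le0)
next
  case (round i A t)
  obtain s where "A = row_alloc n L s i"
    using csrr_rounds_row_alloc[OF round.hyps(1)] round.prems by auto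
  then have A: "A a \<subseteq> set (take (i * n) L)" "a \<noteq> b \<Longrightarrow> A a \<inter> A b = {}" for a b
    using row_alloc_subset row_alloc_disjoint L round.prems by auto
  let ?B = "add_tuple n (shift_tuple n L (Suc i) t) A"
  let ?N = "\<lambda>s. card (new_violations n E L i A s)"
  have "?N (t - 1) \<le> ?N s" if "s < n" for s
    using round.hyps(3)[rule_format, of "Suc s"] that
    by (simp add: violations_add_tuple[OF E L round.prems A(1)])
  then have "n * ?N (t - 1) \<le> (\<Sum>s<n. ?N s)"
    using sum_mono[of "{..<n}" "\<lambda>_. ?N (t - 1)" ?N] by simp
  also have "\<dots> \<le> card {e \<in> E. e \<subseteq> set (take (Suc i * n) L) \<and> \<not> e \<subseteq> set (take (i * n) L)}"
    by (rule sum_new_violations_le[OF E(1) L round.prems A])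
  finally have "n * violations n E ?B \<le> card {e \<in> E. e \<subseteq> set (take (i * n) L)} +
      card {e \<in> E. e \<subseteq> set (take (Suc i * n) L) \<and> \<not> e \<subseteq> set (take (i * n) L)}"
    using round.IH round.prems
    by (simp add: violations_add_tuple[OF E L round.prems A(1)] distrib_left)
  also have "\<dots> = card ({e \<in> E. e \<subseteq> set (take (i * n) L)} \<union>
      {e \<in> E. e \<subseteq> set (take (Suc i * n) L) \<and> \<not> e \<subseteq> set (take (i * n) L)})"
    using E(1) by (intro card_Un_disjoint[symmetric]) auto
  also have "\<dots> \<le> card {e \<in> E. e \<subseteq> set (take (Suc i * n) L)}"
  proof (rule card_mono)
    have "set (take (i * n) L) \<subseteq> set (take (Suc i * n) L)"
      by (rule set_take_subset_set_take) simp
    then show "{e \<in> E. e \<subseteq> set (take (i * n) L)} \<union>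
        {e \<in> E. e \<subseteq> set (take (Suc i * n) L) \<and> \<not> e \<subseteq> set (take (i * n) L)}
      \<subseteq> {e \<in> E. e \<subseteq> set (take (Suc i * n) L)}" by auto
  qed (use E(1) in simp)
  finally show ?case .
qed

subsection \<open>Fairness\<close>

lemma pad_goods_properties:
  assumes "1 \<le> n" "sorted_goods m v L"
  shows "length L = m" "length (pad_goods n m L) = padded_size n m" "distinct (pad_goods n m L)"
    "\<And>k. k < m \<Longrightarrow> pad_goods n m L ! k = L ! k"
    "\<And>k. k < padded_size n m \<Longrightarrow> pad_goods n m L ! k \<in> goods m \<longleftrightarrow> k < m"
proof -
  note p = padded_size_properties[OF assms(1), of m]
  have L: "distinct L" "set L = goods m" using assms(2) by (auto simp: sorted_goods_def)
  then show len: "length L = m"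
    using distinct_card[OF L(1)] by (simp add: goods_def)
  then show "length (pad_goods n m L) = padded_size n m"
    and nth: "\<And>k. k < m \<Longrightarrow> pad_goods n m L ! k = L ! k"
    using p by (auto simp: pad_goods_def nth_append)
  show "distinct (pad_goods n m L)"
    using L p by (auto simp: pad_goods_def goods_def)
  show "pad_goods n m L ! k \<in> goods m \<longleftrightarrow> k < m" if "k < padded_size n m" for k
  proof (cases "k < m")
    case True
    then show ?thesis using nth L len nth_mem[of k L] by auto
  next
    case False
    \<comment> \<open>Positions count from 0 and the first dummy, \<open>Suc m\<close>, stands at
      position \<open>m\<close>.\<close>
    then have "pad_goods n m L ! k = k + 1"
      using that len by (auto simp: pad_goods_def nth_append simp del: upt_Suc)
    then show ?thesis using False by (simp add: goods_def)
  qed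
qed

text \<open>Less than one full row is padded, so dummies occur in the last row only. The index set
  therefore contains all rows below \<open>R - 1\<close>, and possibly the last one.\<close>

lemma row_alloc_goods:
  fixes s :: "nat \<Rightarrow> nat"
  assumes "1 \<le> n" "sorted_goods m v L" "a \<in> agents n"
  defines "R \<equiv> padded_size n m div n" and "idx \<equiv> \<lambda>r. r * n + (s r + (a - 1)) mod n"
  shows "row_alloc n (pad_goods n m L) s R a \<inter> goods m = (\<lambda>r. L ! idx r) ` {r. r < R \<and> idx r < m}"
    "inj_on (\<lambda>r. L ! idx r) {r. r < R \<and> idx r < m}"
    "\<And>r. r < R - 1 \<Longrightarrow> idx r < m"
proof -
  note p = padded_size_properties[OF assms(1), of m]
  note g = pad_goods_properties[OF assms(1,2)]
  have R: "R * n = padded_size n m" using p by (simp add: R_def)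
  have idx: "idx r < i * n" if "r < i" for r i
    using row_index_less[OF that] assms(1) by (simp add: idx_def)
  show "row_alloc n (pad_goods n m L) s R a \<inter> goods m = (\<lambda>r. L ! idx r) ` {r. r < R \<and> idx r < m}"
  proof -
    have "row_alloc n (pad_goods n m L) s R a \<inter> goods m =
        (\<lambda>r. pad_goods n m L ! idx r) ` {..<R} \<inter> goods m"
      unfolding row_alloc_def idx_def using assms(3) by simp
    also have "\<dots> = (\<lambda>r. pad_goods n m L ! idx r) ` {r. r < R \<and> idx r < m}"
      using idx[of _ R] R g(5) by auto
    also have "\<dots> = (\<lambda>r. L ! idx r) ` {r. r < R \<and> idx r < m}"
      using g(4) by (intro image_cong) auto
    finally show ?thesis .
  qed
  have "inj_on idx UNIV"
    using row_index_eq_iff assms(1) by (auto simp: idx_def inj_on_def)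
  then show "inj_on (\<lambda>r. L ! idx r) {r. r < R \<and> idx r < m}"
    using g(1) assms(2) by (auto simp: inj_on_def sorted_goods_def nth_eq_iff_index_eq)
  show "idx r < m" if "r < R - 1" for r
  proof -
    have "idx r < (R - 1) * n" using idx[OF that] .
    also have "\<dots> < m" using p(3) R that mult_le_mono1[of 1 R n]
      by (simp add: diff_mult_distrib less_diff_conv2)
    finally show ?thesis .
  qed
qed

lemma row_alloc_complete:
  assumes "1 \<le> n" "sorted_goods m v L"
  shows "complete_alloc n m (\<lambda>a. row_alloc n (pad_goods n m L) s (padded_size n m div n) a \<inter> goods m)"
proof -
  note p = padded_size_properties[OF assms(1), of m]
  note g = pad_goods_properties[OF assms]
  have "\<exists>a\<in>agents n. x \<in> row_alloc n (pad_goods n m L) s (padded_size n m div n) a"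
    if x: "x \<in> goods m" for x
  proof -
    obtain k where k: "k < m" "x = L ! k"
      using x assms(2) g(1) by (metis in_set_conv_nth sorted_goods_def)
    define r where "r = k div n"
    \<comment> \<open>The column minus the shift modulo \<open>n\<close>. The shift is reduced first
      and subtracted from \<open>n\<close>, so that the truncated subtraction is exact.\<close>
    define b where "b = (k mod n + (n - s r mod n)) mod n"
    have "r < padded_size n m div n"
      using k p assms(1) by (simp add: r_def less_mult_imp_div_less)
    moreover have "(s r + b) mod n = k mod n"
    proof -
      have "(s r + b) mod n = (s r mod n + (k mod n + (n - s r mod n))) mod n"
        unfolding b_def by (metis mod_add_left_eq mod_add_right_eq)
      also have "s r mod n + (k mod n + (n - s r mod n)) = k mod n + n"
        using assms(1) mod_less_divisor[of n "s r"] by linarith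
      finally show ?thesis by simp
    qed
    then have "x = pad_goods n m L ! (r * n + (s r + (Suc b - 1)) mod n)"
      using k g(4) by (simp add: r_def)
    moreover have "Suc b \<in> agents n"
      using assms(1) by (simp add: agents_def b_def Suc_le_eq)
    ultimately show ?thesis
      unfolding row_alloc_def by (intro bexI[of _ "Suc b"]) auto
  qed
  then show ?thesis by (auto simp: complete_alloc_def)
qed

text \<open>Every bundle takes one good from each full row, so its size is \<open>R - 1\<close> or
  \<open>R\<close>.\<close>

lemma row_alloc_balanced:
  assumes "1 \<le> n" "sorted_goods m v L"
  shows "balanced n (\<lambda>a. row_alloc n (pad_goods n m L) s (padded_size n m div n) a \<inter> goods m)"
proof -
  define R where "R = padded_size n m div n"
  have "R - 1 \<le> card (row_alloc n (pad_goods n m L) s R a \<inter> goods m) \<and>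
      card (row_alloc n (pad_goods n m L) s R a \<inter> goods m) \<le> R" if "a \<in> agents n" for a
  proof -
    note rows = row_alloc_goods[OF assms that, where s = s, folded R_def]
    let ?I = "{r. r < R \<and> r * n + (s r + (a - 1)) mod n < m}"
    have "card (row_alloc n (pad_goods n m L) s R a \<inter> goods m) = card ?I"
      unfolding rows(1) using rows(2) by (rule card_image)
    moreover have "card ?I \<le> card {..<R}" by (intro card_mono) auto
    moreover have "card {..<R - 1} \<le> card ?I"
      using rows(3) by (intro card_mono) auto
    ultimately show ?thesis by simp
  qed
  note * = this
  show ?thesis
    unfolding balanced_def R_def[symmetric]
  proof (intro ballI)
    fix i j assume "i \<in> agents n" "j \<in> agents n"
    from *[OF this(1)] *[OF this(2)]
    show "\<bar>int (card (row_alloc n (pad_goods n m L) s R i \<inter> goods m)) -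
      int (card (row_alloc n (pad_goods n m L) s R j \<inter> goods m))\<bar> \<le> 1" by linarith
  qed
qed

text \<open>Without its good in the first row, the bundle of \<open>j\<close> is dominated row by row by the
  bundle of \<open>i\<close>: the good of \<open>j\<close> in row \<open>r + 1\<close> comes after the good of \<open>i\<close> in row \<open>r\<close>.\<close>

lemma row_alloc_EF1:
  assumes "1 \<le> n" "sorted_goods m v L" "additive_valuation (goods m) v"
    and V: "\<And>i S. i \<in> agents n \<Longrightarrow> S \<subseteq> goods m \<Longrightarrow> V i S = v S"
  shows "EF1 n V (\<lambda>a. row_alloc n (pad_goods n m L) s (padded_size n m div n) a \<inter> goods m)"
proof -
  define R where "R = padded_size n m div n"
  define A where "A a = row_alloc n (pad_goods n m L) s R a \<inter> goods m" for a
  define idx where "idx a r = r * n + (s r + (a - 1)) mod n" for a r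
  define I where "I a = {r. r < R \<and> idx a r < m}" for a
  define g where "g a = (\<lambda>r. L ! idx a r)" for a
  have A: "A a = g a ` I a" "inj_on (g a) (I a)" "\<And>r. r < R - 1 \<Longrightarrow> idx a r < m" if "a \<in> agents n" for a
    using row_alloc_goods[OF assms(1,2) that, where s = s]
    by (simp_all add: A_def g_def I_def idx_def R_def)
  have len: "length L = m" using pad_goods_properties[OF assms(1,2)] by simp
  have gm: "g a r \<in> goods m" if "r \<in> I a" for a r
    using that len assms(2) nth_mem[of "idx a r" L] by (auto simp: g_def I_def sorted_goods_def)
  have v: "0 \<le> v S" "v S = (\<Sum>x\<in>S. v {x})" if "S \<subseteq> goods m" for S
    using assms(3) that unfolding additive_valuation_def by blast+
  have "\<exists>x\<in>A j. v (A j - {x}) \<le> v (A i)"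
    if ij: "i \<in> agents n" "j \<in> agents n" and ne: "A j \<noteq> {}" for i j
  proof -
    \<comment> \<open>Real goods precede the dummies in the order. If \<open>j\<close> has a real
      good in any row, its good in the first row is real as well, and that is the good to
      remove.\<close>
    have 0: "0 \<in> I j"
    proof -
      obtain r where "r \<in> I j" using ne A(1)[OF ij(2)] by auto
      moreover have "idx j 0 \<le> idx j r"
      proof (cases r)
        case (Suc r')
        have "(s 0 + (j - 1)) mod n \<le> n" using assms(1) by (intro less_imp_le) simp
        then show ?thesis by (simp add: idx_def Suc)
      qed simp
      ultimately show ?thesis by (auto simp: I_def)
    qed
    have next_row: "v {g j (Suc r)} \<le> v {g i r}" and row: "r \<in> I i" if "Suc r \<in> I j" for r
    proof -
      have "idx i r < Suc r * n" using row_index_less[of r "Suc r" _ n] assms(1) by (simp add: idx_def)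
      then have less: "idx i r < idx j (Suc r)" by (simp add: idx_def)
      then show "r \<in> I i" using that by (simp add: I_def)
      show "v {g j (Suc r)} \<le> v {g i r}"
        using assms(2) that less len by (auto simp: sorted_goods_def sorted_wrt_iff_nth_less g_def I_def)
    qed
    have "A j - {g j 0} = g j ` (I j - {0})"
      using A(1,2)[OF ij(2)] 0 by (auto simp: inj_on_def)
    also have "I j - {0} = Suc ` {r. Suc r \<in> I j}"
      by (auto simp: image_iff) (metis not0_implies_Suc)
    finally have Aj: "A j - {g j 0} = (\<lambda>r. g j (Suc r)) ` {r. Suc r \<in> I j}"
      by (simp add: image_image)
    have "v (A j - {g j 0}) = (\<Sum>x\<in>A j - {g j 0}. v {x})"
      by (intro v) (auto simp: A_def)
    also have "\<dots> = (\<Sum>r | Suc r \<in> I j. v {g j (Suc r)})"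
      unfolding Aj using A(2)[OF ij(2)] by (subst sum.reindex) (auto simp: inj_on_def)
    also have "\<dots> \<le> (\<Sum>r | Suc r \<in> I j. v {g i r})"
      by (intro sum_mono next_row) simp
    \<comment> \<open>Goods of \<open>i\<close> that have no good of \<open>j\<close> in the
      following row are worth at least 0.\<close>
    also have "\<dots> \<le> (\<Sum>r\<in>I i. v {g i r})"
      using row gm v(1) by (intro sum_mono2) (auto simp: I_def)
    also have "\<dots> = (\<Sum>x\<in>A i. v {x})"
      unfolding A(1)[OF ij(1)] using A(2)[OF ij(1)] by (simp add: sum.reindex)
    also have "\<dots> = v (A i)"
      by (intro v(2)[symmetric]) (auto simp: A_def)
    finally show ?thesis using 0 A(1)[OF ij(2)] by auto
  qed
  moreover have "A a \<subseteq> goods m" "A a - X \<subseteq> goods m" for a X by (auto simp: A_def)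
  ultimately show ?thesis
    unfolding EF1_def R_def[symmetric] A_def[symmetric] using V by metis
qed

lemma cyclic_shift_rr_correct:
  assumes "fd_instance n m V E" "identical_valuations n m V v" "cyclic_shift_rr n m v E A"
  shows "allocation n m A" "complete_alloc n m A" "balanced n A" "EF1 n V A"
    "real (violations n E A) \<le> real (card E) / real n"
proof -
  have n: "1 \<le> n" and E: "\<And>e. e \<in> E \<Longrightarrow> e \<subseteq> goods m \<and> card e = 2"
    using assms(1) by (auto simp: fd_instance_def simple_graph_on_def)
  have V: "V i S = v S" if "i \<in> agents n" "S \<subseteq> goods m" for i S
    using assms(2) that by (simp add: identical_valuations_def)
  \<comment> \<open>Additivity is assumed for the valuations of the agents. It passes to
    \<open>v\<close> through agent 1, who exists because \<open>1 \<le> n\<close>.\<close>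
  have v: "additive_valuation (goods m) v"
  proof -
    have one: "1 \<in> agents n" using n by (simp add: agents_def)
    then have "additive_valuation (goods m) (V 1)" using assms(1) by (auto simp: fd_instance_def)
    note V1 = this
    show ?thesis
      unfolding additive_valuation_def
    proof (intro allI impI)
      fix S assume S: "S \<subseteq> goods m"
      have "(\<Sum>g\<in>S. V 1 {g}) = (\<Sum>g\<in>S. v {g})"
        by (intro sum.cong V[OF one]) (use S in auto)
      moreover have "0 \<le> V 1 S \<and> V 1 S = (\<Sum>g\<in>S. V 1 {g})"
        using V1 S unfolding additive_valuation_def by blast
      ultimately show "0 \<le> v S \<and> v S = (\<Sum>g\<in>S. v {g})"
        using V[OF one S] by metis
    qed
  qed
  have finE: "finite E"
    by (rule finite_subset[of _ "Pow (goods m)"]) (use E in \<open>auto simp: goods_def\<close>)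
  define R where "R = padded_size n m div n"
  obtain L B where L: "sorted_goods m v L" and B: "csrr_rounds n E (pad_goods n m L) R B"
    and AB: "A = (\<lambda>a. B a \<inter> goods m)"
    using assms(3) unfolding cyclic_shift_rr_def R_def by blast
  note g = pad_goods_properties[OF n L]
  have R: "R * n = padded_size n m"
    using padded_size_properties(2)[OF n, of m] by (simp add: R_def)
  obtain s where s: "B = row_alloc n (pad_goods n m L) s R"
    using csrr_rounds_row_alloc[OF B] R g(2) by auto
  show "complete_alloc n m A"
    using row_alloc_complete[OF n L] by (simp add: AB s R_def)
  show "balanced n A"
    using row_alloc_balanced[OF n L] by (simp add: AB s R_def)
  show "EF1 n V A"
    using row_alloc_EF1[OF n L v V] by (simp add: AB s R_def)
  show "allocation n m A"
  proof -
    have "B a \<inter> B b = {}" if "a \<noteq> b" for a b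
      unfolding s using g(3) _ that by (rule row_alloc_disjoint) (simp add: R g(2))
    then show ?thesis unfolding allocation_def AB by blast
  qed
  \<comment> \<open>Edges consist of real goods, so removing the dummies changes no
    violation.\<close>
  have "violations n E A = violations n E B"
    unfolding violations_def AB using E by (metis (no_types, lifting) Int_subset_iff)
  moreover have "n * violations n E B \<le> card {e \<in> E. e \<subseteq> set (take (R * n) (pad_goods n m L))}"
    using E R g(2,3) by (intro csrr_rounds_violations_le[OF B]) (auto simp: finE)
  moreover have "\<dots> \<le> card E" by (intro card_mono finE) auto
  ultimately have "n * violations n E A \<le> card E" by simp
  then have "real n * real (violations n E A) \<le> real (card E)"
    by (metis of_nat_le_iff of_nat_mult)
  then show "real (violations n E A) \<le> real (card E) / real n"
    using n by (simp add: field_simps)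
qed

subsection \<open>Cost bounds for programs\<close>

text \<open>Total correctness with an upper bound on the cost. Since programs are deterministic, one
  terminating execution says everything; a bound instead of the exact cost lets branches of
  different length share a triple.\<close>

definition runs :: "(nat \<Rightarrow> real) \<Rightarrow> com \<Rightarrow> state \<Rightarrow> nat \<Rightarrow> (state \<Rightarrow> bool) \<Rightarrow> bool" where
  "runs w c \<sigma> B Q \<longleftrightarrow> (\<exists>t \<tau>. exec w c \<sigma> t \<tau> \<and> t \<le> B \<and> Q \<tau>)"

lemma runs_weaken:
  assumes "runs w c \<sigma> B Q" "B \<le> B'" "\<And>\<tau>. Q \<tau> \<Longrightarrow> Q' \<tau>"
  shows "runs w c \<sigma> B' Q'"
  using assms unfolding runs_def by (meson order.trans)

text \<open>Brings a triple into the shape of the premise of \<open>runs_While\<close>, where the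
  postcondition refers to the bound itself.\<close>

lemma runs_exI:
  assumes "runs w c \<sigma> B Q" "\<And>\<tau>. Q \<tau> \<Longrightarrow> Q' B \<tau>"
  shows "\<exists>B. runs w c \<sigma> B (Q' B)"
  using assms unfolding runs_def by blast

lemma runs_Seq:
  assumes "runs w c \<sigma> B P" "\<And>\<tau>. P \<tau> \<Longrightarrow> runs w d \<tau> B' Q" "B + B' + 1 \<le> B''"
  shows "runs w (Seq c d) \<sigma> B'' Q"
proof -
  obtain t \<tau> where c: "exec w c \<sigma> t \<tau>" "t \<le> B" "P \<tau>" using assms(1) unfolding runs_def by blast
  obtain u \<upsilon> where d: "exec w d \<tau> u \<upsilon>" "u \<le> B'" "Q \<upsilon>"
    using assms(2)[OF c(3)] unfolding runs_def by blast
  show ?thesis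
    unfolding runs_def using exec.Seq[OF c(1) d(1)] c(2) d(2,3) assms(3)
    by (intro exI[of _ "t + u + 1"] exI[of _ \<upsilon>]) simp
qed

fun loop_free :: "com \<Rightarrow> bool" where
  "loop_free (Seq c d) \<longleftrightarrow> loop_free c \<and> loop_free d"
| "loop_free (If b c d) \<longleftrightarrow> loop_free c \<and> loop_free d"
| "loop_free (While b c) \<longleftrightarrow> False"
| "loop_free c \<longleftrightarrow> True"

fun step :: "(nat \<Rightarrow> real) \<Rightarrow> com \<Rightarrow> state \<Rightarrow> state" where
  "step w (Assign x e) \<sigma> = \<sigma>\<lparr>reg := (reg \<sigma>)(x := aval e \<sigma>)\<rparr>"
| "step w (Store r e f) \<sigma> = \<sigma>\<lparr>arr := (arr \<sigma>)(r := (arr \<sigma> r)(aval e \<sigma> := aval f \<sigma>))\<rparr>"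
| "step w (Seq c d) \<sigma> = step w d (step w c \<sigma>)"
| "step w (If b c d) \<sigma> = (if bval w b \<sigma> then step w c \<sigma> else step w d \<sigma>)"
| "step w c \<sigma> = \<sigma>"

fun max_cost :: "com \<Rightarrow> nat" where
  "max_cost (Assign x e) = acost e + 1"
| "max_cost (Store r e f) = acost e + acost f + 1"
| "max_cost (Seq c d) = max_cost c + max_cost d + 1"
| "max_cost (If b c d) = bcost b + max_cost c + max_cost d + 1"
| "max_cost c = 1"

text \<open>Straight-line code is verified by evaluation: \<open>step\<close> gives the final state
  and \<open>max_cost\<close> a number that depends on the syntax alone. For a conditional both
  branches are charged, which avoids a maximum.\<close>

lemma runs_loop_free:
  assumes "loop_free c" "Q (step w c \<sigma>)" "max_cost c \<le> B"
  shows "runs w c \<sigma> B Q"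
proof -
  have "\<exists>t \<le> max_cost c. exec w c \<sigma> t (step w c \<sigma>)"
    using assms(1)
  proof (induction c arbitrary: \<sigma>)
    case (Seq c d)
    then obtain t u where "t \<le> max_cost c" "exec w c \<sigma> t (step w c \<sigma>)"
      "u \<le> max_cost d" "exec w d (step w c \<sigma>) u (step w d (step w c \<sigma>))"
      by (metis loop_free.simps(1))
    then show ?case
      using exec.Seq[of w c \<sigma> t "step w c \<sigma>" d u] by (intro exI[of _ "t + u + 1"]) auto
  next
    case (If b c d)
    then obtain t u where "t \<le> max_cost c" "exec w c \<sigma> t (step w c \<sigma>)"
      "u \<le> max_cost d" "exec w d \<sigma> u (step w d \<sigma>)"
      by (metis loop_free.simps(2))
    then show ?case
      using exec.IfTrue[of w b \<sigma> c t "step w c \<sigma>" d] exec.IfFalse[of w b \<sigma> d u "step w d \<sigma>" c]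
      by (intro exI[of _ "bcost b + (if bval w b \<sigma> then t else u) + 1"]) auto
  qed (use exec.Skip[of w] exec.Assign[of w] exec.Store[of w] in \<open>auto intro: exI[of _ "Suc _"]\<close>)
  then show ?thesis using assms(2,3) unfolding runs_def by (meson order.trans)
qed

fun written_regs :: "com \<Rightarrow> nat set" where
  "written_regs (Assign x e) = {x}"
| "written_regs (Seq c d) = written_regs c \<union> written_regs d"
| "written_regs (If b c d) = written_regs c \<union> written_regs d"
| "written_regs (While b c) = written_regs c"
| "written_regs c = {}"

fun written_arrs :: "com \<Rightarrow> nat set" where
  "written_arrs (Store r e f) = {r}"
| "written_arrs (Seq c d) = written_arrs c \<union> written_arrs d"
| "written_arrs (If b c d) = written_arrs c \<union> written_arrs d"
| "written_arrs (While b c) = written_arrs c"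
| "written_arrs c = {}"

text \<open>The frame is read off the syntax, so that loop invariants need to mention only the
  memory that a loop changes.\<close>

definition framed :: "com \<Rightarrow> state \<Rightarrow> state \<Rightarrow> bool" where
  "framed c \<sigma> \<tau> \<longleftrightarrow>
     (\<forall>x. x \<notin> written_regs c \<longrightarrow> reg \<tau> x = reg \<sigma> x) \<and>
     (\<forall>r. r \<notin> written_arrs c \<longrightarrow> arr \<tau> r = arr \<sigma> r)"

lemma exec_framed: "exec w c \<sigma> t \<tau> \<Longrightarrow> framed c \<sigma> \<tau>"
  by (induction rule: exec.induct) (auto simp: framed_def)

lemma runs_framed:
  assumes "runs w c \<sigma> B Q"
  shows "runs w c \<sigma> B (\<lambda>\<tau>. Q \<tau> \<and> framed c \<sigma> \<tau>)"
  using assms exec_framed unfolding runs_def by blast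

text \<open>The first argument of the invariant is a potential that pays for the remaining iterations.\<close>

lemma runs_While:
  assumes "I p \<sigma>"
    and step: "\<And>p \<tau>. I p \<tau> \<Longrightarrow> framed c \<sigma> \<tau> \<Longrightarrow> bval w b \<tau> \<Longrightarrow>
      \<exists>B. runs w c \<tau> B (\<lambda>\<upsilon>. \<exists>q. I q \<upsilon> \<and> q + B + bcost b + 1 \<le> p)"
    and "p + bcost b + 1 \<le> B"
  shows "runs w (While b c) \<sigma> B (\<lambda>\<tau>. (\<exists>q. I q \<tau>) \<and> \<not> bval w b \<tau> \<and> framed c \<sigma> \<tau>)"
proof -
  \<comment> \<open>The potential also yields termination: each iteration lowers it by at least
    \<open>bcost b + 1\<close>, so it serves as the induction measure.\<close>
  have "\<exists>t \<tau>. exec w (While b c) \<rho> t \<tau> \<and> t \<le> p + bcost b + 1 \<and> (\<exists>q. I q \<tau>) \<and> \<not> bval w b \<tau>"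
    if "I p \<rho>" "framed c \<sigma> \<rho>" for \<rho>
    using that
  proof (induction p arbitrary: \<rho> rule: less_induct)
    case (less p)
    show ?case
    proof (cases "bval w b \<rho>")
      case True
      then obtain B t \<tau> q where c: "exec w c \<rho> t \<tau>" "t \<le> B" "I q \<tau>" "q + B + bcost b + 1 \<le> p"
        using step[OF less.prems True] unfolding runs_def by blast
      moreover have "framed c \<sigma> \<tau>"
        using less.prems(2) exec_framed[OF c(1)] by (simp add: framed_def)
      ultimately obtain u \<upsilon> where "exec w (While b c) \<tau> u \<upsilon>" "u \<le> q + bcost b + 1"
        "\<exists>q. I q \<upsilon>" "\<not> bval w b \<upsilon>"
        using less.IH[of q \<tau>] by auto
      then show ?thesis
        using exec.WhileTrue[OF True c(1), of u \<upsilon>] c(2,4)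
        by (intro exI[of _ "bcost b + t + u + 1"] exI[of _ \<upsilon>]) auto
    next
      case False
      then show ?thesis
        using exec.WhileFalse[OF False, of c] less.prems
        by (intro exI[of _ "bcost b + 1"] exI[of _ \<rho>]) auto
    qed
  qed
  then obtain t \<tau> where "exec w (While b c) \<sigma> t \<tau>" "t \<le> p + bcost b + 1"
    "\<exists>q. I q \<tau>" "\<not> bval w b \<tau>"
    using assms(1) unfolding framed_def by blast
  then show ?thesis
    using exec_framed[of w "While b c" \<sigma> t \<tau>] assms(3)
    unfolding runs_def by (intro exI[of _ t] exI[of _ \<tau>]) (auto simp: framed_def)
qed

lemma runs_While_loop_free:
  assumes "I p \<sigma>" "loop_free c"
    and step: "\<And>p \<tau>. I p \<tau> \<Longrightarrow> framed c \<sigma> \<tau> \<Longrightarrow> bval w b \<tau> \<Longrightarrow>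
      \<exists>q. I q (step w c \<tau>) \<and> q + max_cost c + bcost b + 1 \<le> p"
    and "p + bcost b + 1 \<le> B"
  shows "runs w (While b c) \<sigma> B (\<lambda>\<tau>. (\<exists>q. I q \<tau>) \<and> \<not> bval w b \<tau> \<and> framed c \<sigma> \<tau>)"
  using assms(1) _ assms(4)
proof (rule runs_While)
  fix p \<tau> assume "I p \<tau>" "framed c \<sigma> \<tau>" "bval w b \<tau>"
  from step[OF this] show "\<exists>B. runs w c \<tau> B (\<lambda>\<upsilon>. \<exists>q. I q \<upsilon> \<and> q + B + bcost b + 1 \<le> p)"
    using assms(2) by (blast intro: runs_loop_free)
qed

subsection \<open>Merge sort\<close>

abbreviation (input) seq :: "com \<Rightarrow> com \<Rightarrow> com" (infixr ";;" 60) where "c ;; d \<equiv> Seq c d"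

abbreviation (input) "rN \<equiv> 0 :: nat"
abbreviation (input) "rM \<equiv> 1 :: nat"
abbreviation (input) "rE \<equiv> 2 :: nat"
abbreviation (input) "rK \<equiv> 3 :: nat"
abbreviation (input) "rI \<equiv> 4 :: nat"
abbreviation (input) "rIend \<equiv> 5 :: nat"
abbreviation (input) "rJ \<equiv> 6 :: nat"
abbreviation (input) "rJend \<equiv> 7 :: nat"
abbreviation (input) "rWidth \<equiv> 8 :: nat"
abbreviation (input) "rRow \<equiv> 9 :: nat"
abbreviation (input) "rCol \<equiv> 10 :: nat"
abbreviation (input) "rStart \<equiv> 11 :: nat"
abbreviation (input) "rShift \<equiv> 12 :: nat"
abbreviation (input) "rX \<equiv> 13 :: nat"
abbreviation (input) "rY \<equiv> 14 :: nat"
abbreviation (input) "rT \<equiv> 15 :: nat"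

abbreviation (input) "aFst \<equiv> 0 :: nat"
abbreviation (input) "aSnd \<equiv> 1 :: nat"
abbreviation (input) "aOwner \<equiv> 2 :: nat"
abbreviation (input) "aOrd \<equiv> 3 :: nat"
abbreviation (input) "aTmp \<equiv> 4 :: nat"
abbreviation (input) "aRow \<equiv> 5 :: nat"
abbreviation (input) "aCol \<equiv> 6 :: nat"
abbreviation (input) "aHead \<equiv> 7 :: nat"
abbreviation (input) "aNext \<equiv> 8 :: nat"
abbreviation (input) "aCnt \<equiv> 9 :: nat"

abbreviation (input) incr :: "nat \<Rightarrow> com" where
  "incr x \<equiv> Assign x (Add (Reg x) (Num 1))"

definition init_body :: com where
  "init_body = Store aOrd (Reg rK) (Add (Reg rK) (Num 1)) ;; incr rK"

definition init_loop :: com where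
  "init_loop = While (Less (Reg rK) (Reg rM)) init_body"

lemma runs_init_loop:
  assumes "reg \<sigma> rK = 0"
  shows "runs w init_loop \<sigma> (20 * reg \<sigma> rM + 20) (\<lambda>\<tau>. \<forall>k<reg \<sigma> rM. arr \<tau> aOrd k = Suc k)"
proof -
  let ?I = "\<lambda>p \<tau>. reg \<tau> rK \<le> reg \<sigma> rM \<and> (\<forall>k<reg \<tau> rK. arr \<tau> aOrd k = Suc k) \<and>
    p = 20 * (reg \<sigma> rM - reg \<tau> rK)"
  have "runs w init_loop \<sigma> (20 * reg \<sigma> rM + 20)
    (\<lambda>\<tau>. (\<exists>q. ?I q \<tau>) \<and> \<not> bval w (Less (Reg rK) (Reg rM)) \<tau> \<and> framed init_body \<sigma> \<tau>)"
    unfolding init_loop_def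
    by (rule runs_While_loop_free[where p = "20 * reg \<sigma> rM"])
      (auto simp: assms init_body_def framed_def less_Suc_eq)
  then show ?thesis
    by (rule runs_weaken) (auto simp: init_body_def framed_def)
qed

definition decreasing_on :: "(nat \<Rightarrow> real) \<Rightarrow> (nat \<Rightarrow> nat) \<Rightarrow> nat \<Rightarrow> nat \<Rightarrow> bool" where
  "decreasing_on w f a b \<longleftrightarrow> (\<forall>x y. a \<le> x \<and> x < y \<and> y < b \<longrightarrow> w (f y) \<le> w (f x))"

text \<open>Ties go to the left run. If the left run is exhausted, then \<open>rK < rJend\<close>
  leaves a good in the right run, so the second branch needs no test of its own.\<close>

definition merge_body :: com where
  "merge_body =
     If (And (Less (Reg rI) (Reg rIend))
             (Not (And (Less (Reg rJ) (Reg rJend))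
                       (LessVal (Read aOrd (Reg rI)) (Read aOrd (Reg rJ))))))
       (Store aTmp (Reg rK) (Read aOrd (Reg rI)) ;; incr rI)
       (Store aTmp (Reg rK) (Read aOrd (Reg rJ)) ;; incr rJ) ;;
     incr rK"

definition merge_loop :: com where
  "merge_loop = While (Less (Reg rK) (Reg rJend)) merge_body"

text \<open>The array \<open>g\<close> from \<open>a\<close> on holds the merge of the consumed parts \<open>[a, i)\<close> and \<open>[b, j)\<close> of
  the runs \<open>[a, b)\<close> and \<open>[b, c)\<close> of \<open>f\<close>.\<close>

definition merged :: "(nat \<Rightarrow> real) \<Rightarrow> (nat \<Rightarrow> nat) \<Rightarrow> nat \<Rightarrow> nat \<Rightarrow> nat \<Rightarrow> nat \<Rightarrow> nat \<Rightarrow> (nat \<Rightarrow> nat) \<Rightarrow> bool"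
  where
  "merged w f a b c i j g \<longleftrightarrow>
     a \<le> i \<and> i \<le> b \<and> b \<le> j \<and> j \<le> c \<and>
     g ` {a..<i + j - b} = f ` ({a..<i} \<union> {b..<j}) \<and>
     decreasing_on w g a (i + j - b) \<and>
     (\<forall>x\<in>{a..<i + j - b}. \<forall>y\<in>{i..<b} \<union> {j..<c}. w (f y) \<le> w (g x))"

lemma image_upd_Suc:
  assumes "a \<le> (k :: nat)"
  shows "(g(k := x)) ` {a..<Suc k} = insert x (g ` {a..<k})"
proof -
  have "{a..<Suc k} = insert k {a..<k}" using assms by auto
  then show ?thesis by auto
qed

text \<open>The last conjunct of \<open>merged\<close> is what keeps the output decreasing: whatever
  is unconsumed is worth at most whatever is written. The new entry satisfies it because it heads
  its own run and is worth at least the head of the other run.\<close>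

lemma merged_step_left:
  assumes "merged w f a b c i j g" "i < b" "j < c \<Longrightarrow> w (f j) \<le> w (f i)"
    and f: "decreasing_on w f a b" "decreasing_on w f b c"
  shows "merged w f a b c (Suc i) j (g(i + j - b := f i))"
proof -
  note m = assms(1)[unfolded merged_def]
  let ?k = "i + j - b"
  have k: "Suc i + j - b = Suc ?k" "a \<le> ?k" using m assms(2) by auto
  have "(g(?k := f i)) ` {a..<Suc ?k} = f ` ({a..<Suc i} \<union> {b..<j})"
    unfolding image_upd_Suc[OF k(2)] using m by (auto simp: atLeastLessThanSuc)
  moreover have "decreasing_on w (g(?k := f i)) a (Suc ?k)"
    using m assms(2) by (auto simp: decreasing_on_def less_Suc_eq)
  moreover have "w (f y) \<le> w ((g(?k := f i)) x)"
    if "x \<in> {a..<Suc ?k}" "y \<in> {Suc i..<b} \<union> {j..<c}" for x y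
  proof (cases "x = ?k")
    case True
    have "w (f y) \<le> w (f i)" if "j \<le> y" "y < c"
    proof -
      have "w (f y) \<le> w (f j)" using f(2) m that by (cases "y = j") (auto simp: decreasing_on_def)
      then show ?thesis using assms(3) that by auto
    qed
    then show ?thesis using True that f(1) m by (auto simp: decreasing_on_def)
  qed (use that m in auto)
  ultimately show ?thesis using m assms(2) unfolding merged_def k by auto
qed

lemma merged_step_right:
  assumes "merged w f a b c i j g" "j < c" "i < b \<Longrightarrow> w (f i) \<le> w (f j)"
    and f: "decreasing_on w f a b" "decreasing_on w f b c"
  shows "merged w f a b c i (Suc j) (g(i + j - b := f j))"
proof -
  note m = assms(1)[unfolded merged_def]
  let ?k = "i + j - b"
  have k: "i + Suc j - b = Suc ?k" "a \<le> ?k" using m assms(2) by auto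
  have "(g(?k := f j)) ` {a..<Suc ?k} = f ` ({a..<i} \<union> {b..<Suc j})"
    unfolding image_upd_Suc[OF k(2)] using m by (auto simp: atLeastLessThanSuc)
  moreover have "decreasing_on w (g(?k := f j)) a (Suc ?k)"
    using m assms(2) by (auto simp: decreasing_on_def less_Suc_eq)
  moreover have "w (f y) \<le> w ((g(?k := f j)) x)"
    if "x \<in> {a..<Suc ?k}" "y \<in> {i..<b} \<union> {Suc j..<c}" for x y
  proof (cases "x = ?k")
    case True
    have "w (f y) \<le> w (f j)" if "i \<le> y" "y < b"
    proof -
      have "w (f y) \<le> w (f i)" using f(1) m that by (cases "y = i") (auto simp: decreasing_on_def)
      then show ?thesis using assms(3) that by auto
    qed
    then show ?thesis using True that f(2) m by (auto simp: decreasing_on_def)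
  qed (use that m in auto)
  ultimately show ?thesis using m assms(2) unfolding merged_def k by auto
qed

text \<open>The frame protects whole arrays only. The conjunct on positions below \<open>a\<close>
  protects the blocks that were merged earlier in the same pass.\<close>

lemma runs_merge_loop:
  assumes "reg \<sigma> rK = a" "reg \<sigma> rI = a" "reg \<sigma> rIend = b" "reg \<sigma> rJ = b" "reg \<sigma> rJend = c"
    and "a \<le> b" "b \<le> c" "decreasing_on w (arr \<sigma> aOrd) a b" "decreasing_on w (arr \<sigma> aOrd) b c"
  shows "runs w merge_loop \<sigma> (60 * (c - a) + 10)
    (\<lambda>\<tau>. reg \<tau> rK = c \<and> arr \<tau> aTmp ` {a..<c} = arr \<sigma> aOrd ` {a..<c} \<and>
      decreasing_on w (arr \<tau> aTmp) a c \<and> (\<forall>x<a. arr \<tau> aTmp x = arr \<sigma> aTmp x))"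
proof -
  let ?f = "arr \<sigma> aOrd"
  let ?I = "\<lambda>p \<tau>. merged w ?f a b c (reg \<tau> rI) (reg \<tau> rJ) (arr \<tau> aTmp) \<and>
    reg \<tau> rK = reg \<tau> rI + reg \<tau> rJ - b \<and> (\<forall>x<a. arr \<tau> aTmp x = arr \<sigma> aTmp x) \<and>
    p = 60 * (c - reg \<tau> rK)"
  have "runs w merge_loop \<sigma> (60 * (c - a) + 10)
    (\<lambda>\<tau>. (\<exists>q. ?I q \<tau>) \<and> \<not> bval w (Less (Reg rK) (Reg rJend)) \<tau> \<and> framed merge_body \<sigma> \<tau>)"
    unfolding merge_loop_def
  proof (rule runs_While_loop_free[where p = "60 * (c - a)"])
    show "?I (60 * (c - a)) \<sigma>"
      using assms by (auto simp: merged_def decreasing_on_def)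
    show "loop_free merge_body" by (simp add: merge_body_def)
    fix p \<tau>
    assume I: "?I p \<tau>" and fr: "framed merge_body \<sigma> \<tau>" and less: "bval w (Less (Reg rK) (Reg rJend)) \<tau>"
    have regs: "reg \<tau> rIend = b" "reg \<tau> rJend = c" "arr \<tau> aOrd = ?f"
      using fr assms by (auto simp: framed_def merge_body_def)
    have m: "a \<le> reg \<tau> rI" "reg \<tau> rI \<le> b" "b \<le> reg \<tau> rJ" "reg \<tau> rJ \<le> c"
      using I by (auto simp: merged_def)
    have less: "reg \<tau> rI + reg \<tau> rJ - b < c" using less regs I by simp
    let ?left = "reg \<tau> rI < b \<and> \<not> (reg \<tau> rJ < c \<and> w (?f (reg \<tau> rI)) < w (?f (reg \<tau> rJ)))"
    show "\<exists>q. ?I q (step w merge_body \<tau>) \<and>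
      q + max_cost merge_body + bcost (Less (Reg rK) (Reg rJend)) + 1 \<le> p"
    proof (cases ?left)
      case True
      then have "merged w ?f a b c (Suc (reg \<tau> rI)) (reg \<tau> rJ)
          ((arr \<tau> aTmp)(reg \<tau> rI + reg \<tau> rJ - b := ?f (reg \<tau> rI)))"
        using I assms by (intro merged_step_left) auto
      then show ?thesis
        using I True m less by (auto simp: merge_body_def regs)
    next
      case False
      then have "merged w ?f a b c (reg \<tau> rI) (Suc (reg \<tau> rJ))
          ((arr \<tau> aTmp)(reg \<tau> rI + reg \<tau> rJ - b := ?f (reg \<tau> rJ)))"
        using I assms m less by (intro merged_step_right) auto
      then show ?thesis
        using I False m less by (auto simp: merge_body_def regs)
    qed
  qed (simp)
  then show ?thesis
  proof (rule runs_weaken)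
    fix \<tau>
    assume "(\<exists>q. ?I q \<tau>) \<and> \<not> bval w (Less (Reg rK) (Reg rJend)) \<tau> \<and> framed merge_body \<sigma> \<tau>"
    then have I: "?I (60 * (c - reg \<tau> rK)) \<tau>" and K: "\<not> reg \<tau> rK < c"
      using assms by (auto simp: framed_def merge_body_def)
    then have "reg \<tau> rI = b" "reg \<tau> rJ = c" by (auto simp: merged_def)
    moreover have "{a..<b} \<union> {b..<c} = {a..<c}" using assms(6,7) by auto
    ultimately show "reg \<tau> rK = c \<and> arr \<tau> aTmp ` {a..<c} = ?f ` {a..<c} \<and>
      decreasing_on w (arr \<tau> aTmp) a c \<and> (\<forall>x<a. arr \<tau> aTmp x = arr \<sigma> aTmp x)"
      using I by (simp add: merged_def)
  qed simp
qed

text \<open>Both ends are cut off at \<open>m\<close>. The right run may become empty, and the merge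
  is then a plain copy.\<close>

definition pass_setup :: com where
  "pass_setup =
     Assign rI (Reg rK) ;;
     Assign rIend (Add (Reg rK) (Reg rWidth)) ;;
     If (Less (Reg rM) (Reg rIend)) (Assign rIend (Reg rM)) Skip ;;
     Assign rJ (Reg rIend) ;;
     Assign rJend (Add (Reg rIend) (Reg rWidth)) ;;
     If (Less (Reg rM) (Reg rJend)) (Assign rJend (Reg rM)) Skip"

definition pass_body :: com where
  "pass_body = pass_setup ;; merge_loop"

definition pass_loop :: com where
  "pass_loop = While (Less (Reg rK) (Reg rM)) pass_body"

definition copy_body :: com where
  "copy_body = Store aOrd (Reg rK) (Read aTmp (Reg rK)) ;; incr rK"

definition copy_loop :: com where
  "copy_loop = While (Less (Reg rK) (Reg rM)) copy_body"

definition sort_body :: com where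
  "sort_body =
     Assign rK (Num 0) ;; pass_loop ;; Assign rK (Num 0) ;; copy_loop ;;
     Assign rWidth (Add (Reg rWidth) (Reg rWidth))"

definition sort_loop :: com where
  "sort_loop = While (Less (Reg rWidth) (Reg rM)) sort_body"

lemmas loop_defs = merge_body_def merge_loop_def pass_setup_def pass_body_def pass_loop_def
  copy_body_def copy_loop_def sort_body_def sort_loop_def

definition sorted_blocks :: "(nat \<Rightarrow> real) \<Rightarrow> (nat \<Rightarrow> nat) \<Rightarrow> nat \<Rightarrow> nat \<Rightarrow> bool" where
  "sorted_blocks w f d m \<longleftrightarrow> (\<forall>b. d dvd b \<longrightarrow> decreasing_on w f b (min (b + d) m))"

lemma runs_pass_body:
  assumes "reg \<sigma> rK = k" "reg \<sigma> rWidth = d" "reg \<sigma> rM = m" "k < m" "1 \<le> d" "d dvd k"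
    and "sorted_blocks w (arr \<sigma> aOrd) d m"
  defines "c \<equiv> min (k + 2 * d) m"
  shows "runs w pass_body \<sigma> (60 * (c - k) + 60)
    (\<lambda>\<tau>. reg \<tau> rK = c \<and> arr \<tau> aTmp ` {k..<c} = arr \<sigma> aOrd ` {k..<c} \<and>
      decreasing_on w (arr \<tau> aTmp) k c \<and> (\<forall>x<k. arr \<tau> aTmp x = arr \<sigma> aTmp x) \<and>
      framed pass_body \<sigma> \<tau>)"
proof -
  let ?b = "min (k + d) m"
  let ?P = "\<lambda>\<tau> :: state. reg \<tau> rK = k \<and> reg \<tau> rI = k \<and> reg \<tau> rIend = ?b \<and> reg \<tau> rJ = ?b \<and> reg \<tau> rJend = c \<and>
    arr \<tau> = arr \<sigma>"
  have "runs w pass_setup \<sigma> 45 ?P"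
    by (rule runs_loop_free) (use assms in \<open>auto simp: pass_setup_def c_def\<close>)
  moreover have "runs w merge_loop \<tau> (60 * (c - k) + 10)
      (\<lambda>\<tau>. reg \<tau> rK = c \<and> arr \<tau> aTmp ` {k..<c} = arr \<sigma> aOrd ` {k..<c} \<and>
        decreasing_on w (arr \<tau> aTmp) k c \<and> (\<forall>x<k. arr \<tau> aTmp x = arr \<sigma> aTmp x))" if "?P \<tau>" for \<tau>
  proof -
    have "decreasing_on w (arr \<sigma> aOrd) k ?b"
      using assms(6,7) by (auto simp: sorted_blocks_def)
    moreover have "decreasing_on w (arr \<sigma> aOrd) ?b c"
    proof (cases "k + d \<le> m")
      case True
      have "decreasing_on w (arr \<sigma> aOrd) (k + d) (min (k + d + d) m)"
        using assms(6,7) by (auto simp: sorted_blocks_def)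
      then show ?thesis using True by (simp add: c_def mult_2 add.assoc)
    qed (simp add: c_def decreasing_on_def)
    ultimately show ?thesis
      using runs_merge_loop[of \<tau> k ?b c w] that assms(4) by (simp add: c_def)
  qed
  ultimately have "runs w pass_body \<sigma> (60 * (c - k) + 60)
    (\<lambda>\<tau>. reg \<tau> rK = c \<and> arr \<tau> aTmp ` {k..<c} = arr \<sigma> aOrd ` {k..<c} \<and>
      decreasing_on w (arr \<tau> aTmp) k c \<and> (\<forall>x<k. arr \<tau> aTmp x = arr \<sigma> aTmp x))"
    unfolding pass_body_def by (rule runs_Seq) simp_all
  from runs_framed[OF this] show ?thesis by (simp add: conj_assoc)
qed

lemma runs_pass_loop:
  assumes "reg \<sigma> rK = 0" "reg \<sigma> rWidth = d" "reg \<sigma> rM = m" "1 \<le> d"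
    and "sorted_blocks w (arr \<sigma> aOrd) d m"
  shows "runs w pass_loop \<sigma> (130 * m + 10)
    (\<lambda>\<tau>. arr \<tau> aTmp ` {..<m} = arr \<sigma> aOrd ` {..<m} \<and> sorted_blocks w (arr \<tau> aTmp) (2 * d) m)"
proof -
  let ?f = "arr \<sigma> aOrd"
  \<comment> \<open>Divisibility is demanded only before the end, since the last block may be cut
    off at an \<open>m\<close> that is not a multiple of \<open>2 * d\<close>.\<close>
  let ?I = "\<lambda>p \<tau>. reg \<tau> rK \<le> m \<and> (reg \<tau> rK < m \<longrightarrow> 2 * d dvd reg \<tau> rK) \<and>
    arr \<tau> aTmp ` {..<reg \<tau> rK} = ?f ` {..<reg \<tau> rK} \<and>
    (\<forall>b<reg \<tau> rK. 2 * d dvd b \<longrightarrow> decreasing_on w (arr \<tau> aTmp) b (min (b + 2 * d) m)) \<and>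
    p = 130 * (m - reg \<tau> rK)"
  have "runs w pass_loop \<sigma> (130 * m + 10)
    (\<lambda>\<tau>. (\<exists>q. ?I q \<tau>) \<and> \<not> bval w (Less (Reg rK) (Reg rM)) \<tau> \<and> framed pass_body \<sigma> \<tau>)"
    unfolding pass_loop_def
  proof (rule runs_While[where p = "130 * m"])
    show "?I (130 * m) \<sigma>" using assms by simp
    fix p \<tau>
    assume I: "?I p \<tau>" and fr: "framed pass_body \<sigma> \<tau>" and less: "bval w (Less (Reg rK) (Reg rM)) \<tau>"
    have regs: "reg \<tau> rWidth = d" "reg \<tau> rM = m" "arr \<tau> aOrd = ?f"
      using fr assms by (auto simp: framed_def loop_defs)
    define k where "k = reg \<tau> rK"
    define c where "c = min (k + 2 * d) m"
    have k: "k < m" "2 * d dvd k" "d dvd k"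
      using less regs I by (auto simp: k_def intro: dvd_trans[of d "2 * d"])
    have c: "k < c" "c \<le> m" using k assms(4) by (auto simp: c_def)
    have "runs w pass_body \<tau> (60 * (c - k) + 60)
      (\<lambda>\<upsilon>. reg \<upsilon> rK = c \<and> arr \<upsilon> aTmp ` {k..<c} = ?f ` {k..<c} \<and>
        decreasing_on w (arr \<upsilon> aTmp) k c \<and> (\<forall>x<k. arr \<upsilon> aTmp x = arr \<tau> aTmp x) \<and>
        framed pass_body \<tau> \<upsilon>)"
      using runs_pass_body[of \<tau> k d m w] k assms regs by (simp add: k_def c_def)
    then show "\<exists>B. runs w pass_body \<tau> B
      (\<lambda>\<upsilon>. \<exists>q. ?I q \<upsilon> \<and> q + B + bcost (Less (Reg rK) (Reg rM)) + 1 \<le> p)"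
    proof (rule runs_exI)
      fix \<upsilon>
      assume "reg \<upsilon> rK = c \<and> arr \<upsilon> aTmp ` {k..<c} = ?f ` {k..<c} \<and>
        decreasing_on w (arr \<upsilon> aTmp) k c \<and> (\<forall>x<k. arr \<upsilon> aTmp x = arr \<tau> aTmp x) \<and>
        framed pass_body \<tau> \<upsilon>"
      then have post: "reg \<upsilon> rK = c" "arr \<upsilon> aTmp ` {k..<c} = ?f ` {k..<c}"
        "decreasing_on w (arr \<upsilon> aTmp) k c" "\<And>x. x < k \<Longrightarrow> arr \<upsilon> aTmp x = arr \<tau> aTmp x" by auto
      have split: "{..<c} = {..<k} \<union> {k..<c}" using c by auto
      have "arr \<upsilon> aTmp ` {..<k} = ?f ` {..<k}" using post(4) I by (simp add: k_def)
      then have "arr \<upsilon> aTmp ` {..<c} = ?f ` {..<c}"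
        unfolding split image_Un using post(2) by simp
      moreover have "c < m \<longrightarrow> 2 * d dvd c" using k by (auto simp: c_def min_def)
      moreover have "decreasing_on w (arr \<upsilon> aTmp) b (min (b + 2 * d) m)"
        if b: "b < c" "2 * d dvd b" for b
      \<comment> \<open>Both \<open>b\<close> and \<open>k\<close> are multiples of
        \<open>2 * d\<close>. A block that starts before \<open>k\<close> thus ends by
        \<open>k\<close> and is left untouched; otherwise \<open>b\<close> is \<open>k\<close>
        itself.\<close>
      proof (cases "b < k")
        case True
        then have "b + 2 * d \<le> k"
          using b k(2) by (metis dvd_diff_nat dvd_imp_le zero_less_diff le_diff_conv2 less_imp_le_nat add.commute)
        then show ?thesis
          using I True b post(4) by (auto simp: decreasing_on_def k_def)
      next
        case False
        moreover have "b < k + 2 * d" using b by (simp add: c_def)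
        ultimately have "b = k"
          using b(2) k(2) by (metis dvd_diff_nat dvd_imp_le zero_less_diff not_less le_antisym less_diff_conv2 add.commute)
        then show ?thesis using post(3) by (simp add: c_def)
      qed
      \<comment> \<open>The iteration advances by at least one position, so the surplus of 70 per
        position covers the fixed cost of 64.\<close>
      moreover have "130 * (m - c) + (60 * (c - k) + 60) + 4 \<le> p"
        using I c by (simp add: k_def)
      ultimately show "\<exists>q. ?I q \<upsilon> \<and> q + (60 * (c - k) + 60) + bcost (Less (Reg rK) (Reg rM)) + 1 \<le> p"
        using post(1) c by (intro exI[of _ "130 * (m - c)"]) simp
    qed
  qed simp
  then show ?thesis
  proof (rule runs_weaken)
    fix \<tau>
    assume "(\<exists>q. ?I q \<tau>) \<and> \<not> bval w (Less (Reg rK) (Reg rM)) \<tau> \<and> framed pass_body \<sigma> \<tau>"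
    then have I: "?I (130 * (m - reg \<tau> rK)) \<tau>" and K: "\<not> reg \<tau> rK < m"
      using assms by (auto simp: framed_def loop_defs)
    then have "reg \<tau> rK = m" by auto
    moreover have "decreasing_on w (arr \<tau> aTmp) b (min (b + 2 * d) m)" if "2 * d dvd b" for b
      using I that \<open>reg \<tau> rK = m\<close> by (cases "b < m") (simp_all add: decreasing_on_def)
    ultimately show "arr \<tau> aTmp ` {..<m} = ?f ` {..<m} \<and> sorted_blocks w (arr \<tau> aTmp) (2 * d) m"
      using I by (simp add: sorted_blocks_def)
  qed simp
qed

lemma runs_copy_loop:
  assumes "reg \<sigma> rK = 0" "reg \<sigma> rM = m"
  shows "runs w copy_loop \<sigma> (20 * m + 10)
    (\<lambda>\<tau>. (\<forall>k<m. arr \<tau> aOrd k = arr \<sigma> aTmp k) \<and> framed copy_loop \<sigma> \<tau>)"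
proof -
  let ?I = "\<lambda>p \<tau>. reg \<tau> rK \<le> m \<and> (\<forall>k<reg \<tau> rK. arr \<tau> aOrd k = arr \<sigma> aTmp k) \<and>
    p = 20 * (m - reg \<tau> rK)"
  have "runs w copy_loop \<sigma> (20 * m + 10)
    (\<lambda>\<tau>. (\<exists>q. ?I q \<tau>) \<and> \<not> bval w (Less (Reg rK) (Reg rM)) \<tau> \<and> framed copy_body \<sigma> \<tau>)"
    unfolding copy_loop_def
    by (rule runs_While_loop_free[where p = "20 * m"])
      (use assms in \<open>auto simp: copy_body_def framed_def less_Suc_eq\<close>)
  then show ?thesis
    by (rule runs_weaken) (use assms in \<open>auto simp: loop_defs framed_def\<close>)
qed

lemma runs_sort_body:
  assumes "reg \<sigma> rWidth = d" "reg \<sigma> rM = m" "1 \<le> d" "sorted_blocks w (arr \<sigma> aOrd) d m"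
  shows "runs w sort_body \<sigma> (150 * m + 50)
    (\<lambda>\<tau>. reg \<tau> rWidth = 2 * d \<and> arr \<tau> aOrd ` {..<m} = arr \<sigma> aOrd ` {..<m} \<and>
      sorted_blocks w (arr \<tau> aOrd) (2 * d) m)"
proof -
  let ?f = "arr \<sigma> aOrd"
  let ?P1 = "\<lambda>\<tau> :: state. reg \<tau> rK = 0 \<and> reg \<tau> rWidth = d \<and> reg \<tau> rM = m \<and> arr \<tau> = arr \<sigma>"
  let ?P2 = "\<lambda>\<tau> :: state. (arr \<tau> aTmp ` {..<m} = ?f ` {..<m} \<and> sorted_blocks w (arr \<tau> aTmp) (2 * d) m) \<and>
    reg \<tau> rWidth = d \<and> reg \<tau> rM = m"
  let ?P3 = "\<lambda>\<tau> :: state. ?P2 \<tau> \<and> reg \<tau> rK = 0"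
  let ?P4 = "\<lambda>\<tau> :: state. reg \<tau> rWidth = d \<and> arr \<tau> aOrd ` {..<m} = ?f ` {..<m} \<and>
    sorted_blocks w (arr \<tau> aOrd) (2 * d) m"
  let ?Q = "\<lambda>\<tau> :: state. reg \<tau> rWidth = 2 * d \<and> arr \<tau> aOrd ` {..<m} = ?f ` {..<m} \<and>
    sorted_blocks w (arr \<tau> aOrd) (2 * d) m"
  have 1: "runs w (Assign rK (Num 0)) \<sigma> 2 ?P1"
    by (rule runs_loop_free) (use assms in auto)
  have 2: "runs w pass_loop \<tau> (130 * m + 10) ?P2" if P: "?P1 \<tau>" for \<tau>
  proof -
    have "runs w pass_loop \<tau> (130 * m + 10)
      (\<lambda>\<upsilon>. arr \<upsilon> aTmp ` {..<m} = arr \<tau> aOrd ` {..<m} \<and> sorted_blocks w (arr \<upsilon> aTmp) (2 * d) m)"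
      using P assms by (intro runs_pass_loop) auto
    from runs_framed[OF this] show ?thesis
      by (rule runs_weaken) (use P in \<open>auto simp: framed_def loop_defs\<close>)
  qed
  have 3: "runs w (Assign rK (Num 0)) \<tau> 2 ?P3" if "?P2 \<tau>" for \<tau>
    by (rule runs_loop_free) (use that in auto)
  have 4: "runs w copy_loop \<tau> (20 * m + 10) ?P4" if P: "?P3 \<tau>" for \<tau>
  proof -
    have "runs w copy_loop \<tau> (20 * m + 10)
      (\<lambda>\<upsilon>. (\<forall>k<m. arr \<upsilon> aOrd k = arr \<tau> aTmp k) \<and> framed copy_loop \<tau> \<upsilon>)"
      using P by (intro runs_copy_loop) auto
    then show ?thesis
    proof (rule runs_weaken)
      fix \<upsilon> assume u: "(\<forall>k<m. arr \<upsilon> aOrd k = arr \<tau> aTmp k) \<and> framed copy_loop \<tau> \<upsilon>"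
      then have "arr \<upsilon> aOrd ` {..<m} = arr \<tau> aTmp ` {..<m}" by (intro image_cong) auto
      moreover have "sorted_blocks w (arr \<upsilon> aOrd) (2 * d) m \<longleftrightarrow> sorted_blocks w (arr \<tau> aTmp) (2 * d) m"
        using u by (auto simp: sorted_blocks_def decreasing_on_def)
      ultimately show "?P4 \<upsilon>" using u P by (auto simp: framed_def loop_defs)
    qed simp
  qed
  have 5: "runs w (Assign rWidth (Add (Reg rWidth) (Reg rWidth))) \<tau> 4 ?Q" if "?P4 \<tau>" for \<tau>
    by (rule runs_loop_free) (use that in auto)
  have 45: "runs w (copy_loop ;; Assign rWidth (Add (Reg rWidth) (Reg rWidth))) \<tau> (20 * m + 20) ?Q"
    if "?P3 \<tau>" for \<tau>
    using 4[OF that] 5 by (rule runs_Seq) simp_all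
  have 345: "runs w (Assign rK (Num 0) ;; copy_loop ;; Assign rWidth (Add (Reg rWidth) (Reg rWidth)))
      \<tau> (20 * m + 30) ?Q" if "?P2 \<tau>" for \<tau>
    using 3[OF that] 45 by (rule runs_Seq) simp_all
  have 2345: "runs w (pass_loop ;; Assign rK (Num 0) ;; copy_loop ;;
      Assign rWidth (Add (Reg rWidth) (Reg rWidth))) \<tau> (150 * m + 45) ?Q" if "?P1 \<tau>" for \<tau>
    using 2[OF that] 345 by (rule runs_Seq) simp_all
  show ?thesis
    unfolding sort_body_def using 1 2345 by (rule runs_Seq) simp_all
qed

text \<open>The width doubles with every pass, so \<open>h\<close> passes suffice. The program
  computes no logarithm; \<open>h\<close> occurs in the analysis only.\<close>

lemma runs_sort_loop:
  assumes "reg \<sigma> rWidth = 1" "reg \<sigma> rM = m" "m \<le> 2 ^ h"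
  shows "runs w sort_loop \<sigma> ((150 * m + 60) * h + 10)
    (\<lambda>\<tau>. arr \<tau> aOrd ` {..<m} = arr \<sigma> aOrd ` {..<m} \<and> decreasing_on w (arr \<tau> aOrd) 0 m)"
proof -
  let ?I = "\<lambda>p \<tau>. \<exists>q\<le>h. reg \<tau> rWidth = 2 ^ q \<and> p = (150 * m + 60) * (h - q) \<and>
    arr \<tau> aOrd ` {..<m} = arr \<sigma> aOrd ` {..<m} \<and> sorted_blocks w (arr \<tau> aOrd) (2 ^ q) m"
  have "runs w sort_loop \<sigma> ((150 * m + 60) * h + 10)
    (\<lambda>\<tau>. (\<exists>q. ?I q \<tau>) \<and> \<not> bval w (Less (Reg rWidth) (Reg rM)) \<tau> \<and> framed sort_body \<sigma> \<tau>)"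
    unfolding sort_loop_def
  proof (rule runs_While[where p = "(150 * m + 60) * h"])
    show "?I ((150 * m + 60) * h) \<sigma>"
      using assms by (intro exI[of _ 0]) (auto simp: sorted_blocks_def decreasing_on_def)
    fix p \<tau>
    assume I: "?I p \<tau>" and fr: "framed sort_body \<sigma> \<tau>" and less: "bval w (Less (Reg rWidth) (Reg rM)) \<tau>"
    have m: "reg \<tau> rM = m"
      using fr assms by (auto simp: framed_def loop_defs)
    obtain q where q: "q \<le> h" "reg \<tau> rWidth = 2 ^ q" "p = (150 * m + 60) * (h - q)"
      "arr \<tau> aOrd ` {..<m} = arr \<sigma> aOrd ` {..<m}" "sorted_blocks w (arr \<tau> aOrd) (2 ^ q) m"
      using I by blast
    \<comment> \<open>The loop test gives \<open>2 ^ q < m\<close>, so another pass is still paid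
      for.\<close>
    have "(2 :: nat) ^ q < 2 ^ h" using less q m by (intro less_le_trans[OF _ assms(3)]) simp
    then have h: "h - q = Suc (h - Suc q)" "Suc q \<le> h" by (auto simp: Suc_diff_Suc)
    have "runs w sort_body \<tau> (150 * m + 50)
      (\<lambda>\<tau>'. reg \<tau>' rWidth = 2 * 2 ^ q \<and> arr \<tau>' aOrd ` {..<m} = arr \<tau> aOrd ` {..<m} \<and>
        sorted_blocks w (arr \<tau>' aOrd) (2 * 2 ^ q) m)"
      using q m by (intro runs_sort_body) auto
    then show "\<exists>B. runs w sort_body \<tau> B
      (\<lambda>\<upsilon>. \<exists>q. ?I q \<upsilon> \<and> q + B + bcost (Less (Reg rWidth) (Reg rM)) + 1 \<le> p)"
    proof (rule runs_exI)
      fix \<upsilon>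
      assume "reg \<upsilon> rWidth = 2 * 2 ^ q \<and> arr \<upsilon> aOrd ` {..<m} = arr \<tau> aOrd ` {..<m} \<and>
        sorted_blocks w (arr \<upsilon> aOrd) (2 * 2 ^ q) m"
      then have "?I ((150 * m + 60) * (h - Suc q)) \<upsilon>"
        using h q by (intro exI[of _ "Suc q"]) simp
      moreover have "(150 * m + 60) * (h - Suc q) + (150 * m + 50) + 4 \<le> p"
        unfolding q(3) h(1) by simp
      ultimately show "\<exists>q. ?I q \<upsilon> \<and> q + (150 * m + 50) + bcost (Less (Reg rWidth) (Reg rM)) + 1 \<le> p"
        by (intro exI[of _ "(150 * m + 60) * (h - Suc q)"]) simp
    qed
  qed simp
  then show ?thesis
  proof (rule runs_weaken)
    fix \<tau>
    assume *: "(\<exists>q. ?I q \<tau>) \<and> \<not> bval w (Less (Reg rWidth) (Reg rM)) \<tau> \<and> framed sort_body \<sigma> \<tau>"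
    then obtain q where q: "reg \<tau> rWidth = 2 ^ q"
      "arr \<tau> aOrd ` {..<m} = arr \<sigma> aOrd ` {..<m}" "sorted_blocks w (arr \<tau> aOrd) (2 ^ q) m" by blast
    have "m \<le> 2 ^ q" using * q assms by (auto simp: framed_def loop_defs)
    then show "arr \<tau> aOrd ` {..<m} = arr \<sigma> aOrd ` {..<m} \<and> decreasing_on w (arr \<tau> aOrd) 0 m"
      using q(2) q(3)[unfolded sorted_blocks_def, rule_format, of 0] by (simp add: min_def split: if_splits)
  qed simp
qed

subsection \<open>The rounds\<close>

text \<open>The owners set here are those of shift 1. They are final for the first row, and every later
  row is overwritten in its round.\<close>

definition place_body :: com where
  "place_body =
     Store aRow (Read aOrd (Reg rK)) (Reg rRow) ;;
     Store aCol (Read aOrd (Reg rK)) (Reg rCol) ;;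
     Store aOwner (Read aOrd (Reg rK)) (Add (Reg rCol) (Num 1)) ;;
     incr rCol ;;
     If (Less (Reg rCol) (Reg rN)) Skip (incr rRow ;; Assign rCol (Num 0)) ;;
     incr rK"

definition place_loop :: com where
  "place_loop = While (Less (Reg rK) (Reg rM)) place_body"

text \<open>After the exchange \<open>rX\<close> is the row of the later end. Edges inside a row are
  left out, as no shift violates them.\<close>

definition link_body :: com where
  "link_body =
     Assign rX (Read aRow (Read aFst (Reg rK))) ;;
     Assign rY (Read aRow (Read aSnd (Reg rK))) ;;
     If (Less (Reg rX) (Reg rY)) (Assign rT (Reg rX) ;; Assign rX (Reg rY) ;; Assign rY (Reg rT)) Skip ;;
     If (Less (Reg rY) (Reg rX))
       (Store aNext (Reg rK) (Read aHead (Reg rX)) ;; Store aHead (Reg rX) (Add (Reg rK) (Num 1)))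
       Skip ;;
     incr rK"

definition link_loop :: com where
  "link_loop = While (Less (Reg rK) (Reg rE)) link_body"

text \<open>List entries are edge numbers plus 1, since 0 ends a list.\<close>

definition walk_body :: com where
  "walk_body =
     Assign rX (Read aFst (Sub (Reg rK) (Num 1))) ;;
     Assign rY (Read aSnd (Sub (Reg rK) (Num 1))) ;;
     If (Less (Read aRow (Reg rY)) (Read aRow (Reg rX)))
       (Assign rT (Reg rX) ;; Assign rX (Reg rY) ;; Assign rY (Reg rT)) Skip ;;
     Assign rT (Add (Read aCol (Reg rY)) (Num 1)) ;;
     If (Less (Reg rT) (Read aOwner (Reg rX))) (Assign rT (Add (Reg rT) (Reg rN))) Skip ;;
     Assign rT (Sub (Reg rT) (Read aOwner (Reg rX))) ;;
     Store aCnt (Reg rT) (Add (Read aCnt (Reg rT)) (Num 1)) ;;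
     Assign rK (Read aNext (Sub (Reg rK) (Num 1)))"

definition walk_loop :: com where
  "walk_loop = While (Less (Num 0) (Reg rK)) walk_body"

text \<open>The counters are cleared on the way, so the next round finds zeros without a loop of its
  own. The current minimum is kept in \<open>rT\<close>, because its counter is already
  overwritten.\<close>

definition argmin_body :: com where
  "argmin_body =
     If (Less (Read aCnt (Reg rK)) (Reg rT))
       (Assign rT (Read aCnt (Reg rK)) ;; Assign rShift (Reg rK)) Skip ;;
     Store aCnt (Reg rK) (Num 0) ;;
     incr rK"

definition argmin_loop :: com where
  "argmin_loop = While (Less (Reg rK) (Reg rN)) argmin_body"

definition assign_body :: com where
  "assign_body =
     Assign rT (Add (Read aCol (Read aOrd (Reg rK))) (Num 1)) ;;
     If (Less (Reg rShift) (Reg rT)) Skip (Assign rT (Add (Reg rT) (Reg rN))) ;;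
     Store aOwner (Read aOrd (Reg rK)) (Sub (Reg rT) (Reg rShift)) ;;
     incr rK"

text \<open>The second test stops the last row at \<open>m\<close>, before its dummies.\<close>

definition assign_loop :: com where
  "assign_loop = While (And (Less (Reg rK) (Reg rStart)) (Less (Reg rK) (Reg rM))) assign_body"

text \<open>\<open>rStart\<close> is advanced before the row is handed out and then serves as the
  upper end in \<open>assign_loop\<close>.\<close>

definition round_body :: com where
  "round_body =
     Assign rK (Read aHead (Reg rRow)) ;;
     walk_loop ;;
     (Assign rShift (Num 0) ;; Assign rT (Read aCnt (Num 0)) ;; Assign rK (Num 0)) ;;
     argmin_loop ;;
     (Assign rK (Reg rStart) ;; Assign rStart (Add (Reg rStart) (Reg rN)) ;; incr rRow) ;;
     assign_loop"

definition round_loop :: com where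
  "round_loop = While (Less (Reg rStart) (Reg rM)) round_body"

lemmas main_loop_defs = place_body_def place_loop_def link_body_def link_loop_def
  walk_body_def walk_loop_def argmin_body_def argmin_loop_def assign_body_def assign_loop_def
  round_body_def round_loop_def

section \<open>Effect and cost of the single loops\<close>

lemma runs_place_loop:
  assumes "reg \<sigma> rK = 0" "reg \<sigma> rRow = 0" "reg \<sigma> rCol = 0" "reg \<sigma> rM = m" "reg \<sigma> rN = n" "1 \<le> n"
    and "inj_on (arr \<sigma> aOrd) {..<m}"
  shows "runs w place_loop \<sigma> (50 * m + 10)
    (\<lambda>\<tau>. \<forall>k<m. arr \<tau> aRow (arr \<sigma> aOrd k) = k div n \<and> arr \<tau> aCol (arr \<sigma> aOrd k) = k mod n \<and>
      arr \<tau> aOwner (arr \<sigma> aOrd k) = Suc (k mod n))"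
proof -
  let ?f = "arr \<sigma> aOrd"
  let ?I = "\<lambda>p \<tau> :: state. reg \<tau> rK \<le> m \<and> reg \<tau> rRow = reg \<tau> rK div n \<and> reg \<tau> rCol = reg \<tau> rK mod n \<and>
    (\<forall>k<reg \<tau> rK. arr \<tau> aRow (?f k) = k div n \<and> arr \<tau> aCol (?f k) = k mod n \<and>
      arr \<tau> aOwner (?f k) = Suc (k mod n)) \<and>
    p = 50 * (m - reg \<tau> rK)"
  have "runs w place_loop \<sigma> (50 * m + 10)
    (\<lambda>\<tau>. (\<exists>q. ?I q \<tau>) \<and> \<not> bval w (Less (Reg rK) (Reg rM)) \<tau> \<and> framed place_body \<sigma> \<tau>)"
    unfolding place_loop_def
  proof (rule runs_While_loop_free[where p = "50 * m"])
    show "?I (50 * m) \<sigma>" using assms by simp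
    show "loop_free place_body" by (simp add: place_body_def)
    fix p \<tau>
    assume I: "?I p \<tau>" and fr: "framed place_body \<sigma> \<tau>" and less: "bval w (Less (Reg rK) (Reg rM)) \<tau>"
    have regs: "reg \<tau> rM = m" "reg \<tau> rN = n" "arr \<tau> aOrd = ?f"
      using fr assms by (auto simp: framed_def main_loop_defs)
    have K: "reg \<tau> rK < m" using less regs by simp
    \<comment> \<open>The tables are indexed by goods, not positions. Since the order is injective,
      an entry for one position never overwrites that of an earlier one.\<close>
    have inj: "?f k \<noteq> ?f (reg \<tau> rK)" if "k < reg \<tau> rK" for k
      using assms(7) that K by (auto dest: inj_onD)
    have "Suc (reg \<tau> rK mod n) < n \<longleftrightarrow> Suc (reg \<tau> rK mod n) \<noteq> n"
      using assms(6) mod_less_divisor[of n "reg \<tau> rK"] by linarith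
    then show "\<exists>q. ?I q (step w place_body \<tau>) \<and>
        q + max_cost place_body + bcost (Less (Reg rK) (Reg rM)) + 1 \<le> p"
      using I K regs inj
      by (auto simp: place_body_def less_Suc_eq div_Suc mod_Suc)
  qed simp
  then show ?thesis
    by (rule runs_weaken) (use assms in \<open>auto simp: main_loop_defs framed_def\<close>)
qed

fun chain :: "(nat \<Rightarrow> nat) \<Rightarrow> nat \<Rightarrow> nat list \<Rightarrow> bool" where
  "chain nxt p [] \<longleftrightarrow> p = 0"
| "chain nxt p (e # es) \<longleftrightarrow> p = Suc e \<and> chain nxt (nxt e) es"

lemma chain_upd: "k \<notin> set es \<Longrightarrow> chain (nxt(k := x)) p es \<longleftrightarrow> chain nxt p es"
  by (induction es arbitrary: p) auto

text \<open>Edges are pushed at the front of the list of their row, hence the reversed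
  order.\<close>

definition late_edges :: "state \<Rightarrow> nat \<Rightarrow> nat \<Rightarrow> nat list" where
  "late_edges \<sigma> k r = filter (\<lambda>e. arr \<sigma> aRow (arr \<sigma> aFst e) \<noteq> arr \<sigma> aRow (arr \<sigma> aSnd e) \<and>
     max (arr \<sigma> aRow (arr \<sigma> aFst e)) (arr \<sigma> aRow (arr \<sigma> aSnd e)) = r) (rev [0..<k])"

lemma late_edges_Suc:
  "late_edges \<sigma> (Suc k) r =
    (if arr \<sigma> aRow (arr \<sigma> aFst k) \<noteq> arr \<sigma> aRow (arr \<sigma> aSnd k) \<and>
        max (arr \<sigma> aRow (arr \<sigma> aFst k)) (arr \<sigma> aRow (arr \<sigma> aSnd k)) = r
     then k # late_edges \<sigma> k r else late_edges \<sigma> k r)"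
  by (simp add: late_edges_def)

lemma notin_late_edges: "k \<notin> set (late_edges \<sigma> k r)"
  by (simp add: late_edges_def)

text \<open>When edge \<open>k\<close> is pushed, all listed edges have smaller numbers. Its
  successor entry is therefore fresh, and setting it disturbs no chain.\<close>

lemma runs_link_loop:
  assumes "reg \<sigma> rK = 0" "reg \<sigma> rE = l" "\<And>r. arr \<sigma> aHead r = 0"
  shows "runs w link_loop \<sigma> (70 * l + 10)
    (\<lambda>\<tau>. \<forall>r. chain (arr \<tau> aNext) (arr \<tau> aHead r) (late_edges \<sigma> l r))"
proof -
  let ?I = "\<lambda>p \<tau> :: state. reg \<tau> rK \<le> l \<and>
    (\<forall>r. chain (arr \<tau> aNext) (arr \<tau> aHead r) (late_edges \<sigma> (reg \<tau> rK) r)) \<and>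
    p = 70 * (l - reg \<tau> rK)"
  have "runs w link_loop \<sigma> (70 * l + 10)
    (\<lambda>\<tau>. (\<exists>q. ?I q \<tau>) \<and> \<not> bval w (Less (Reg rK) (Reg rE)) \<tau> \<and> framed link_body \<sigma> \<tau>)"
    unfolding link_loop_def
  proof (rule runs_While_loop_free[where p = "70 * l"])
    show "?I (70 * l) \<sigma>" using assms by (simp add: late_edges_def)
    show "loop_free link_body" by (simp add: link_body_def)
    fix p \<tau>
    assume I: "?I p \<tau>" and fr: "framed link_body \<sigma> \<tau>" and less: "bval w (Less (Reg rK) (Reg rE)) \<tau>"
    have regs: "reg \<tau> rE = l" "arr \<tau> aRow = arr \<sigma> aRow" "arr \<tau> aFst = arr \<sigma> aFst" "arr \<tau> aSnd = arr \<sigma> aSnd"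
      using fr assms by (auto simp: framed_def main_loop_defs)
    then show "\<exists>q. ?I q (step w link_body \<tau>) \<and>
        q + max_cost link_body + bcost (Less (Reg rK) (Reg rE)) + 1 \<le> p"
      using I less
      by (auto simp: link_body_def late_edges_Suc chain_upd notin_late_edges max_def)
  qed simp
  then show ?thesis
    by (rule runs_weaken) (use assms in \<open>auto simp: main_loop_defs framed_def\<close>)
qed

text \<open>The shift, counted from 0, that gives the later end of edge \<open>e\<close> to the owner of the earlier
  end.\<close>

definition bad_shift :: "state \<Rightarrow> nat \<Rightarrow> nat" where
  "bad_shift \<sigma> e =
     (let x = arr \<sigma> aFst e; y = arr \<sigma> aSnd e;
          (x', y') = (if arr \<sigma> aRow y < arr \<sigma> aRow x then (y, x) else (x, y));
          t = Suc (arr \<sigma> aCol y')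
      in (if t < arr \<sigma> aOwner x' then t + reg \<sigma> rN else t) - arr \<sigma> aOwner x')"

lemma runs_walk_loop:
  assumes "chain (arr \<sigma> aNext) (reg \<sigma> rK) ls"
  shows "runs w walk_loop \<sigma> (80 * length ls + 10)
    (\<lambda>\<tau>. \<forall>s. arr \<tau> aCnt s = arr \<sigma> aCnt s + length (filter (\<lambda>e. bad_shift \<sigma> e = s) ls))"
proof -
  \<comment> \<open>What is counted plus what is still on the list stays constant, which avoids
    splitting \<open>ls\<close> into a walked and a remaining part.\<close>
  let ?I = "\<lambda>p \<tau> :: state. \<exists>ks. chain (arr \<sigma> aNext) (reg \<tau> rK) ks \<and>
    (\<forall>s. arr \<tau> aCnt s + length (filter (\<lambda>e. bad_shift \<sigma> e = s) ks) =
      arr \<sigma> aCnt s + length (filter (\<lambda>e. bad_shift \<sigma> e = s) ls)) \<and>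
    p = 80 * length ks"
  have "runs w walk_loop \<sigma> (80 * length ls + 10)
    (\<lambda>\<tau>. (\<exists>q. ?I q \<tau>) \<and> \<not> bval w (Less (Num 0) (Reg rK)) \<tau> \<and> framed walk_body \<sigma> \<tau>)"
    unfolding walk_loop_def
  proof (rule runs_While_loop_free[where p = "80 * length ls"])
    show "?I (80 * length ls) \<sigma>" using assms by blast
    show "loop_free walk_body" by (simp add: walk_body_def)
    fix p \<tau>
    assume I: "?I p \<tau>" and fr: "framed walk_body \<sigma> \<tau>" and less: "bval w (Less (Num 0) (Reg rK)) \<tau>"
    have regs: "reg \<tau> rN = reg \<sigma> rN" "arr \<tau> aRow = arr \<sigma> aRow" "arr \<tau> aFst = arr \<sigma> aFst"
      "arr \<tau> aSnd = arr \<sigma> aSnd" "arr \<tau> aCol = arr \<sigma> aCol" "arr \<tau> aOwner = arr \<sigma> aOwner"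
      "arr \<tau> aNext = arr \<sigma> aNext"
      using fr by (auto simp: framed_def main_loop_defs)
    from I obtain ks where ks: "chain (arr \<sigma> aNext) (reg \<tau> rK) ks"
      "\<And>s. arr \<tau> aCnt s + length (filter (\<lambda>e. bad_shift \<sigma> e = s) ks) =
        arr \<sigma> aCnt s + length (filter (\<lambda>e. bad_shift \<sigma> e = s) ls)"
      "p = 80 * length ks" by blast
    then obtain e es where ks_eq: "ks = e # es" using less by (cases ks) auto
    then have e: "reg \<tau> rK = Suc e" "chain (arr \<sigma> aNext) (arr \<sigma> aNext e) es" using ks by auto
    have K: "reg (step w walk_body \<tau>) rK = arr \<sigma> aNext e"
      and cnt: "arr (step w walk_body \<tau>) aCnt = (arr \<tau> aCnt)(bad_shift \<sigma> e := Suc (arr \<tau> aCnt (bad_shift \<sigma> e)))"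
      using e(1) regs by (auto simp: walk_body_def bad_shift_def Let_def)
    have "arr (step w walk_body \<tau>) aCnt s + length (filter (\<lambda>e. bad_shift \<sigma> e = s) es) =
        arr \<sigma> aCnt s + length (filter (\<lambda>e. bad_shift \<sigma> e = s) ls)" for s
      using ks(2)[of s] by (auto simp: cnt ks_eq split: if_splits)
    then have "?I (80 * length es) (step w walk_body \<tau>)"
      using e(2) K by (intro exI[of _ es]) simp
    moreover have "80 * length es + max_cost walk_body + bcost (Less (Num 0) (Reg rK)) + 1 \<le> p"
      using ks(3) by (simp add: ks_eq walk_body_def)
    ultimately show "\<exists>q. ?I q (step w walk_body \<tau>) \<and>
        q + max_cost walk_body + bcost (Less (Num 0) (Reg rK)) + 1 \<le> p"
      by blast
  qed simp
  then show ?thesis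
  proof (rule runs_weaken)
    fix \<tau>
    assume *: "(\<exists>q. ?I q \<tau>) \<and> \<not> bval w (Less (Num 0) (Reg rK)) \<tau> \<and> framed walk_body \<sigma> \<tau>"
    then obtain ks where ks: "chain (arr \<sigma> aNext) (reg \<tau> rK) ks"
      "\<And>s. arr \<tau> aCnt s + length (filter (\<lambda>e. bad_shift \<sigma> e = s) ks) =
        arr \<sigma> aCnt s + length (filter (\<lambda>e. bad_shift \<sigma> e = s) ls)" by blast
    moreover have "ks = []" using ks(1) * by (cases ks) auto
    ultimately show "\<forall>s. arr \<tau> aCnt s = arr \<sigma> aCnt s + length (filter (\<lambda>e. bad_shift \<sigma> e = s) ls)"
      by simp
  qed simp
qed

lemma runs_argmin_loop:
  assumes "reg \<sigma> rK = 0" "reg \<sigma> rShift = 0" "reg \<sigma> rT = arr \<sigma> aCnt 0" "reg \<sigma> rN = n" "1 \<le> n"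
  shows "runs w argmin_loop \<sigma> (40 * n + 10)
    (\<lambda>\<tau>. reg \<tau> rShift < n \<and> (\<forall>x<n. arr \<sigma> aCnt (reg \<tau> rShift) \<le> arr \<sigma> aCnt x) \<and>
      (\<forall>x<n. arr \<tau> aCnt x = 0))"
proof -
  let ?c = "arr \<sigma> aCnt"
  let ?I = "\<lambda>p \<tau> :: state. reg \<tau> rK \<le> n \<and> reg \<tau> rShift < n \<and> reg \<tau> rT = ?c (reg \<tau> rShift) \<and>
    (\<forall>x<reg \<tau> rK. ?c (reg \<tau> rShift) \<le> ?c x) \<and>
    (\<forall>x. arr \<tau> aCnt x = (if x < reg \<tau> rK then 0 else ?c x)) \<and>
    p = 40 * (n - reg \<tau> rK)"
  have "runs w argmin_loop \<sigma> (40 * n + 10)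
    (\<lambda>\<tau>. (\<exists>q. ?I q \<tau>) \<and> \<not> bval w (Less (Reg rK) (Reg rN)) \<tau> \<and> framed argmin_body \<sigma> \<tau>)"
    unfolding argmin_loop_def
  proof (rule runs_While_loop_free[where p = "40 * n"])
    show "?I (40 * n) \<sigma>" using assms by simp
    show "loop_free argmin_body" by (simp add: argmin_body_def)
    fix p \<tau>
    assume I: "?I p \<tau>" and fr: "framed argmin_body \<sigma> \<tau>" and less: "bval w (Less (Reg rK) (Reg rN)) \<tau>"
    have "reg \<tau> rN = n"
      using fr assms by (auto simp: framed_def main_loop_defs)
    then show "\<exists>q. ?I q (step w argmin_body \<tau>) \<and>
        q + max_cost argmin_body + bcost (Less (Reg rK) (Reg rN)) + 1 \<le> p"
      using I less
      by (auto simp: argmin_body_def less_Suc_eq intro: le_less_trans less_imp_le order.trans)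
  qed simp
  then show ?thesis
    by (rule runs_weaken) (use assms in \<open>auto simp: main_loop_defs framed_def\<close>)
qed

lemma runs_assign_loop:
  assumes "reg \<sigma> rK = a" "reg \<sigma> rStart = b" "reg \<sigma> rM = m" "reg \<sigma> rN = n" "reg \<sigma> rShift = s"
    and "inj_on (arr \<sigma> aOrd) {..<m}"
  shows "runs w assign_loop \<sigma> (50 * (b - a) + 20)
    (\<lambda>\<tau>. (\<forall>k. a \<le> k \<and> k < b \<and> k < m \<longrightarrow> arr \<tau> aOwner (arr \<sigma> aOrd k) =
        (let t = Suc (arr \<sigma> aCol (arr \<sigma> aOrd k)) in (if s < t then t else t + n) - s)) \<and>
      (\<forall>k<a. k < m \<longrightarrow> arr \<tau> aOwner (arr \<sigma> aOrd k) = arr \<sigma> aOwner (arr \<sigma> aOrd k)))"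
proof -
  let ?f = "arr \<sigma> aOrd"
  let ?o = "\<lambda>k. let t = Suc (arr \<sigma> aCol (?f k)) in (if s < t then t else t + n) - s"
  let ?b = "And (Less (Reg rK) (Reg rStart)) (Less (Reg rK) (Reg rM))"
  let ?I = "\<lambda>p \<tau> :: state. a \<le> reg \<tau> rK \<and>
    (\<forall>k. a \<le> k \<and> k < reg \<tau> rK \<and> k < m \<longrightarrow> arr \<tau> aOwner (?f k) = ?o k) \<and>
    (\<forall>k<a. k < m \<longrightarrow> arr \<tau> aOwner (?f k) = arr \<sigma> aOwner (?f k)) \<and>
    p = 50 * (b - reg \<tau> rK)"
  have "runs w assign_loop \<sigma> (50 * (b - a) + 20)
    (\<lambda>\<tau>. (\<exists>q. ?I q \<tau>) \<and> \<not> bval w ?b \<tau> \<and> framed assign_body \<sigma> \<tau>)"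
    unfolding assign_loop_def
  proof (rule runs_While_loop_free[where p = "50 * (b - a)"])
    show "?I (50 * (b - a)) \<sigma>" using assms by simp
    show "loop_free assign_body" by (simp add: assign_body_def)
    fix p \<tau>
    assume I: "?I p \<tau>" and fr: "framed assign_body \<sigma> \<tau>" and less: "bval w ?b \<tau>"
    have regs: "reg \<tau> rStart = b" "reg \<tau> rM = m" "reg \<tau> rN = n" "reg \<tau> rShift = s"
      "arr \<tau> aOrd = ?f" "arr \<tau> aCol = arr \<sigma> aCol"
      using fr assms by (auto simp: framed_def main_loop_defs)
    have K: "reg \<tau> rK < b" "reg \<tau> rK < m" using less regs by auto
    have inj: "?f k \<noteq> ?f (reg \<tau> rK)" if "k < reg \<tau> rK" for k
      using assms(6) that K by (auto dest: inj_onD)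
    then show "\<exists>q. ?I q (step w assign_body \<tau>) \<and> q + max_cost assign_body + bcost ?b + 1 \<le> p"
      using I K regs by (auto simp: assign_body_def less_Suc_eq Let_def)
  qed simp
  then show ?thesis
    by (rule runs_weaken) (use assms in \<open>auto simp: main_loop_defs framed_def\<close>)
qed

section \<open>Memory contents and the rounds of the algorithm\<close>

lemma length_filter_disjoint_le:
  assumes "\<And>x. x \<in> set xs \<Longrightarrow> P x \<Longrightarrow> R x" "\<And>x. x \<in> set xs \<Longrightarrow> Q x \<Longrightarrow> R x"
    and "\<And>x. x \<in> set xs \<Longrightarrow> P x \<Longrightarrow> \<not> Q x"
  shows "length (filter P xs) + length (filter Q xs) \<le> length (filter R xs)"
  using assms by (induction xs) auto

text \<open>The inverse of a shift: who receives column \<open>q\<close>. Agents count from 1,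
  columns and shifts from 0, hence \<open>Suc q\<close>; adding \<open>n\<close> where necessary
  keeps the subtraction positive.\<close>

lemma owner_eq_iff:
  fixes n s a q :: nat
  assumes "s < n" "q < n" "a \<in> agents n"
  shows "(if s < Suc q then Suc q else Suc q + n) - s = a \<longleftrightarrow> (s + (a - 1)) mod n = q"
proof -
  have "a - 1 < n" "1 \<le> a" using assms(3) by (auto simp: agents_def)
  then show ?thesis using assms(1,2) by (subst add_mod_eq_iff) auto
qed

text \<open>The order \<open>L\<close> is a parameter, to be instantiated by the one that the
  sorting phase leaves in memory. Ties between goods are settled from here on.\<close>

locale csrr_input =
  fixes n m :: nat and v :: "nat set \<Rightarrow> real" and E :: "nat set set" and es :: "(nat \<times> nat) list"
    and L :: "nat list"
  assumes n: "1 \<le> n" and L: "sorted_goods m v L"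
    and E: "simple_graph_on (goods m) E" and es: "edge_list E es"
begin

abbreviation padded :: "nat list" where "padded \<equiv> pad_goods n m L"

lemmas pad = pad_goods_properties[OF n L]

lemma E_finite: "finite E" and E_card: "\<forall>e\<in>E. card e = 2"
proof -
  show "finite E"
    by (rule finite_subset[of _ "Pow (goods m)"]) (use E in \<open>auto simp: simple_graph_on_def goods_def\<close>)
  show "\<forall>e\<in>E. card e = 2" using E by (simp add: simple_graph_on_def)
qed

lemma L_inj: "k < m \<Longrightarrow> k' < m \<Longrightarrow> L ! k = L ! k' \<longleftrightarrow> k = k'"
  using L pad(1) by (simp add: sorted_goods_def nth_eq_iff_index_eq)

lemma goods_nth:
  assumes "g \<in> goods m"
  obtains k where "k < m" "g = L ! k"
  using assms L pad(1) unfolding sorted_goods_def by (metis in_set_conv_nth)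

lemma padded_nth_eq_iff:
  assumes "k < m" "j < length padded"
  shows "L ! k = padded ! j \<longleftrightarrow> k = j"
proof -
  have "k < length padded"
    using assms(1) pad(2) padded_size_properties(1)[OF n, of m] by simp
  then show ?thesis
    using nth_eq_iff_index_eq[OF pad(3) _ assms(2)] assms(1) pad(4)[of k] by metis
qed

text \<open>The padded length is a multiple of \<open>n\<close>, so a row that starts at a real good
  is a complete row.\<close>

lemma length_padded:
  assumes "i * n < m"
  shows "Suc i * n \<le> length padded"
proof -
  note p = padded_size_properties[OF n, of m]
  obtain x where x: "padded_size n m = n * x" using p(2) by (auto simp: dvd_def)
  have "i * n < n * x" using assms p(1) x by linarith
  then have "i * n < x * n" by (simp only: mult.commute)
  then have "Suc i \<le> x" by (metis Suc_leI mult_less_cancel2)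
  then have "Suc i * n \<le> x * n" by (rule mult_le_mono1)
  then show ?thesis using pad(2) x by (simp add: mult.commute)
qed

text \<open>Dummies are not stored, and rows from \<open>i\<close> on still hold the provisional
  owners from the placement. The array is therefore tied to \<open>B\<close> on the real goods of
  the first \<open>i\<close> rows only.\<close>

definition tracks :: "nat \<Rightarrow> (nat \<Rightarrow> nat set) \<Rightarrow> (nat \<Rightarrow> nat) \<Rightarrow> bool" where
  "tracks i B own \<longleftrightarrow>
     (\<forall>k<m. \<forall>a. L ! k \<in> B a \<longleftrightarrow> k < i * n \<and> own (L ! k) = a) \<and>
     (\<forall>k<m. k < i * n \<longrightarrow> own (L ! k) \<in> agents n)"

lemma rounds_subset:
  assumes "csrr_rounds n E padded i B" "i * n \<le> length padded"
  shows "B a \<subseteq> set (take (i * n) padded)"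
  using csrr_rounds_row_alloc[OF assms] row_alloc_subset[OF pad(3) assms(2)] by auto

text \<open>Positions split into earlier, current and later rows. In the current row the stored
  owner inverts the shift, as in \<open>owner_eq_iff\<close>; goods of later rows belong to no
  bundle yet.\<close>

lemma tracks_step:
  assumes "tracks i B own" "Suc i * n \<le> length padded" "s < n"
    and old: "\<And>k. k < m \<Longrightarrow> k < i * n \<Longrightarrow> own' (L ! k) = own (L ! k)"
    and new: "\<And>k. k < m \<Longrightarrow> i * n \<le> k \<Longrightarrow> k < Suc i * n \<Longrightarrow>
      own' (L ! k) = (if s < Suc (k mod n) then Suc (k mod n) else Suc (k mod n) + n) - s"
  shows "tracks (Suc i) (add_tuple n (shift_tuple n padded (Suc i) (Suc s)) B) own'"
proof -
  let ?B = "add_tuple n (shift_tuple n padded (Suc i) (Suc s)) B"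
  have B: "L ! k \<in> ?B a \<longleftrightarrow> L ! k \<in> B a \<or> a \<in> agents n \<and> k = i * n + (s + (a - 1)) mod n"
    if k: "k < m" for k a
  proof (cases "a \<in> agents n")
    case True
    then have "i * n + (s + (a - 1)) mod n < length padded"
      using row_index_less[of i "Suc i" "(s + (a - 1)) mod n" n] assms(2) n
      by (intro less_le_trans[OF _ assms(2)]) simp
    then show ?thesis
      using padded_nth_eq_iff[OF k] True unfolding add_tuple_shift_tuple[OF assms(2)] by auto
  qed (simp add: add_tuple_def)
  have row: "k = i * n + k mod n" if "i * n \<le> k" "k < Suc i * n" for k
  proof -
    have "k div n = i" using that n by (intro div_nat_eqI) (simp_all add: mult.commute)
    then show ?thesis using div_mult_mod_eq[of k n] by simp
  qed
  have own_new: "own' (L ! k) = a \<longleftrightarrow> a \<in> agents n \<and> k = i * n + (s + (a - 1)) mod n"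
    if k: "k < m" "i * n \<le> k" "k < Suc i * n" for k a
  proof (cases "a \<in> agents n")
    case True
    have "own' (L ! k) = a \<longleftrightarrow> (s + (a - 1)) mod n = k mod n"
      unfolding new[OF k] using assms(3) n True by (intro owner_eq_iff) simp_all
    also have "\<dots> \<longleftrightarrow> k = i * n + (s + (a - 1)) mod n" using row[OF k(2,3)] by linarith
    finally show ?thesis using True by simp
  next
    case False
    define q where "q = k mod n"
    have "q < n" using n by (simp add: q_def)
    then have "own' (L ! k) \<in> agents n"
      unfolding new[OF k, folded q_def] using assms(3) by (auto simp: agents_def)
    then show ?thesis using False by auto
  qed
  have less: "i * n + (s + (a - 1)) mod n < Suc i * n" for a using n by simp
  have "L ! k \<in> ?B a \<longleftrightarrow> k < Suc i * n \<and> own' (L ! k) = a" if k: "k < m" for k a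
  proof -
    consider "k < i * n" | "i * n \<le> k" "k < Suc i * n" | "Suc i * n \<le> k" by linarith
    then show ?thesis
    proof cases
      case 1
      then show ?thesis using B[OF k] old[OF k] assms(1) k by (auto simp: tracks_def)
    next
      case 2
      then show ?thesis using B[OF k] own_new[OF k] assms(1) k by (auto simp: tracks_def)
    next
      case 3
      then show ?thesis using B[OF k] assms(1) k less[of a] by (auto simp: tracks_def)
    qed
  qed
  moreover have "own' (L ! k) \<in> agents n" if k: "k < m" "k < Suc i * n" for k
    using old[OF k(1)] own_new[OF k(1) _ k(2), of "own' (L ! k)"] assms(1) k
    by (cases "k < i * n") (auto simp: tracks_def)
  ultimately show ?thesis by (simp add: tracks_def)
qed

text \<open>The part of the memory that stays fixed during the rounds.\<close>

definition ready :: "state \<Rightarrow> bool" where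
  "ready \<sigma> \<longleftrightarrow>
     reg \<sigma> rN = n \<and> reg \<sigma> rM = m \<and>
     (\<forall>e<length es. arr \<sigma> aFst e = fst (es ! e) \<and> arr \<sigma> aSnd e = snd (es ! e)) \<and>
     (\<forall>k<m. arr \<sigma> aOrd k = L ! k \<and> arr \<sigma> aRow (L ! k) = k div n \<and> arr \<sigma> aCol (L ! k) = k mod n)"

lemma edge_index:
  assumes "e < length es"
  obtains k k' where "k < m" "k' < m" "fst (es ! e) = L ! k" "snd (es ! e) = L ! k'"
    "{fst (es ! e), snd (es ! e)} \<in> E"
proof -
  have "(\<lambda>(x, y). {x, y}) (es ! e) \<in> E"
    using es assms unfolding edge_list_def by (metis (no_types, lifting) length_map nth_map nth_mem)
  then have in_E: "{fst (es ! e), snd (es ! e)} \<in> E" by (simp add: case_prod_beta)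
  then have "fst (es ! e) \<in> goods m" "snd (es ! e) \<in> goods m"
    using E by (auto simp: simple_graph_on_def)
  then show ?thesis using that in_E by (metis goods_nth)
qed

text \<open>With the edge oriented by rows, the end \<open>L ! k\<close> must be the one already
  owned and \<open>L ! k'\<close> the one handed out now. The owner of the former then determines a
  single shift, in the shape computed by \<open>bad_shift\<close>.\<close>

lemma new_violation_iff:
  assumes "tracks i B own" "\<And>a. B a \<subseteq> set (take (i * n) padded)" "Suc i * n \<le> length padded"
    and "s < n" "k < m" "k' < m" "k div n \<le> k' div n"
  shows "(\<exists>a\<in>agents n. \<exists>x\<in>B a. {L ! k, L ! k'} = {x, padded ! (i * n + (s + (a - 1)) mod n)}) \<longleftrightarrow>
    k div n < i \<and> k' div n = i \<and>
    s = (let t = Suc (k' mod n) in (if t < own (L ! k) then t + n else t) - own (L ! k))" (is "?L \<longleftrightarrow> ?R")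
proof -
  have tr: "L ! j \<in> B a \<longleftrightarrow> j < i * n \<and> own (L ! j) = a" "j < i * n \<Longrightarrow> own (L ! j) \<in> agents n"
    if "j < m" for j a
    using assms(1) that by (auto simp: tracks_def)
  have bound: "i * n + (s + (a - 1)) mod n < Suc i * n" for a using n by simp
  have div_less: "j div n < i \<longleftrightarrow> j < i * n" for j
    using n by (simp add: div_less_iff_less_mult)
  have nth: "L ! j = padded ! (i * n + (s + (a - 1)) mod n) \<longleftrightarrow> j = i * n + (s + (a - 1)) mod n"
    if "j < m" for j a
    using bound assms(3) by (intro padded_nth_eq_iff that) (meson less_le_trans)
  have shift: "j = i * n + (s + (a - 1)) mod n \<longleftrightarrow>
      j div n = i \<and> s = (let t = Suc (j mod n) in (if t < a then t + n else t) - a)"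
    if a: "a \<in> agents n" for j a
  proof -
    have an: "a - 1 < n" "1 \<le> a" using a by (auto simp: agents_def)
    have "j = i * n + (s + (a - 1)) mod n \<longleftrightarrow> j div n = i \<and> (s + (a - 1)) mod n = j mod n"
      using row_index_eq_iff[of "j mod n" n "(s + (a - 1)) mod n" "j div n" i] n by auto
    also have "(s + (a - 1)) mod n = j mod n \<longleftrightarrow>
        s = (let t = Suc (j mod n) in (if t < a then t + n else t) - a)"
      using an n by (subst add_mod_eq_iff[OF assms(4) an(1)]) (auto simp: Let_def)
    finally show ?thesis .
  qed
  show ?thesis
  proof
    assume ?L
    then obtain a x where a: "a \<in> agents n" "x \<in> B a"
      "{L ! k, L ! k'} = {x, padded ! (i * n + (s + (a - 1)) mod n)}" by blast
    from a(3) consider "L ! k = x" "L ! k' = padded ! (i * n + (s + (a - 1)) mod n)"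
      | "L ! k' = x" "L ! k = padded ! (i * n + (s + (a - 1)) mod n)"
      by (auto simp: doubleton_eq_iff)
    then show ?R
    proof cases
      case 1
      then have "k < i * n" "own (L ! k) = a" using a(2) tr assms(5) by auto
      moreover have "k' = i * n + (s + (a - 1)) mod n" using 1(2) nth assms(6) by blast
      ultimately show ?thesis using shift[OF a(1), of k'] div_less by blast
    next
      case 2
      then have "k' < i * n" using a(2) tr assms(6) by auto
      moreover have "k = i * n + (s + (a - 1)) mod n" using 2(2) nth assms(5) by blast
      then have "k div n = i" using shift[OF a(1), of k] by blast
      ultimately show ?thesis using assms(7) div_less[of k'] by linarith
    qed
  next
    assume R: ?R
    define a where "a = own (L ! k)"
    have a: "a \<in> agents n" "L ! k \<in> B a" using R tr[OF assms(5)] div_less by (auto simp: a_def)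
    moreover have "L ! k' = padded ! (i * n + (s + (a - 1)) mod n)"
      using R shift[OF a(1), of k'] nth[OF assms(6)] unfolding a_def by blast
    ultimately show ?L by metis
  qed
qed

text \<open>The list \<open>es\<close> has every edge once, so edge numbers correspond bijectively
  to edges, and the counter of a shift is the number of violations that it would add.\<close>

lemma card_new_violations:
  assumes \<sigma>: "ready \<sigma>" and tr: "tracks i B (arr \<sigma> aOwner)"
    and B: "\<And>a. B a \<subseteq> set (take (i * n) padded)" "Suc i * n \<le> length padded" and s: "s < n"
  shows "card (new_violations n E padded i B s) =
    length (filter (\<lambda>e. bad_shift \<sigma> e = s) (late_edges \<sigma> (length es) i))"
proof -
  let ?ls = "filter (\<lambda>e. bad_shift \<sigma> e = s) (late_edges \<sigma> (length es) i)"
  define \<phi> where "\<phi> e = {fst (es ! e), snd (es ! e)}" for e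
  have \<phi>: "\<phi> e = map (\<lambda>(x, y). {x, y}) es ! e" if "e < length es" for e
    using that by (simp add: \<phi>_def case_prod_beta)
  have iff: "e \<in> set ?ls \<longleftrightarrow> \<phi> e \<in> new_violations n E padded i B s" if e: "e < length es" for e
  proof -
    obtain k k' where k: "k < m" "k' < m" "fst (es ! e) = L ! k" "snd (es ! e) = L ! k'" "\<phi> e \<in> E"
      using edge_index[OF e] unfolding \<phi>_def by metis
    have rows: "arr \<sigma> aFst e = L ! k" "arr \<sigma> aSnd e = L ! k'" "reg \<sigma> rN = n"
      "\<And>k. k < m \<Longrightarrow> arr \<sigma> aRow (L ! k) = k div n" "\<And>k. k < m \<Longrightarrow> arr \<sigma> aCol (L ! k) = k mod n"
      using \<sigma> e k by (auto simp: ready_def)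
    have in_ls: "e \<in> set ?ls \<longleftrightarrow> k div n \<noteq> k' div n \<and> max (k div n) (k' div n) = i \<and> bad_shift \<sigma> e = s"
      using e k rows by (auto simp: late_edges_def)
    have new: "\<phi> e \<in> new_violations n E padded i B s \<longleftrightarrow>
        (\<exists>a\<in>agents n. \<exists>x\<in>B a. {L ! k, L ! k'} = {x, padded ! (i * n + (s + (a - 1)) mod n)})"
      using k(5) by (simp add: new_violations_def \<phi>_def k)
    show ?thesis
    proof (cases "k' div n < k div n")
      case True
      then have bad: "bad_shift \<sigma> e = (let t = Suc (k mod n) in
          (if t < arr \<sigma> aOwner (L ! k') then t + n else t) - arr \<sigma> aOwner (L ! k'))"
        using k rows by (simp add: bad_shift_def Let_def)
      have swap: "{L ! k, L ! k'} = {L ! k', L ! k}" by (rule insert_commute)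
      show ?thesis
        unfolding in_ls new swap new_violation_iff[OF tr B s k(2,1) less_imp_le[OF True]] bad[symmetric]
        using True by auto
    next
      case False
      then have bad: "bad_shift \<sigma> e = (let t = Suc (k' mod n) in
          (if t < arr \<sigma> aOwner (L ! k) then t + n else t) - arr \<sigma> aOwner (L ! k))"
        using k rows by (simp add: bad_shift_def Let_def)
      show ?thesis
        unfolding in_ls new new_violation_iff[OF tr B s k(1,2) leI[OF False]] bad[symmetric]
        using False by auto
    qed
  qed
  have "inj_on \<phi> (set ?ls)"
  proof (rule inj_onI)
    fix x y assume xy: "x \<in> set ?ls" "y \<in> set ?ls" "\<phi> x = \<phi> y"
    then have "x < length es" "y < length es" by (auto simp: late_edges_def)
    then show "x = y"
      using xy(3) \<phi> es nth_eq_iff_index_eq[of "map (\<lambda>(x, y). {x, y}) es" x y]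
      by (simp add: edge_list_def)
  qed
  moreover have "\<phi> ` set ?ls = new_violations n E padded i B s"
  proof
    show "\<phi> ` set ?ls \<subseteq> new_violations n E padded i B s"
      using iff by (auto simp: late_edges_def)
    show "new_violations n E padded i B s \<subseteq> \<phi> ` set ?ls"
    proof
      fix f assume f: "f \<in> new_violations n E padded i B s"
      then have "f \<in> set (map (\<lambda>(x, y). {x, y}) es)"
        using es by (auto simp: new_violations_def edge_list_def)
      then obtain e where e: "e < length es" "f = \<phi> e"
        using \<phi> by (auto simp: in_set_conv_nth)
      then show "f \<in> \<phi> ` set ?ls" using iff f by blast
    qed
  qed
  ultimately have "card (new_violations n E padded i B s) = card (set ?ls)"
    by (metis card_image)
  also have "\<dots> = length ?ls" by (rule distinct_card) (simp add: late_edges_def)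
  finally show ?thesis .
qed

text \<open>Any run of the algorithm that agrees with the owner array will do, hence the quantified
  \<open>B\<close>. The zero counters are what the next walk adds to.\<close>

definition round_state :: "nat \<Rightarrow> state \<Rightarrow> bool" where
  "round_state i \<sigma> \<longleftrightarrow>
     ready \<sigma> \<and> reg \<sigma> rRow = i \<and> reg \<sigma> rStart = i * n \<and>
     (\<forall>r. chain (arr \<sigma> aNext) (arr \<sigma> aHead r) (late_edges \<sigma> (length es) r)) \<and>
     (\<forall>x<n. arr \<sigma> aCnt x = 0) \<and>
     (\<exists>B. csrr_rounds n E padded i B \<and> tracks i B (arr \<sigma> aOwner))"

text \<open>The violations from earlier rounds are the same for all shifts, so comparing the new
  ones decides the minimum.\<close>

lemma csrr_round_min:
  assumes "csrr_rounds n E padded i B" "Suc i * n \<le> length padded" "s < n"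
    and "\<And>x. x < n \<Longrightarrow> card (new_violations n E padded i B s) \<le> card (new_violations n E padded i B x)"
  shows "csrr_rounds n E padded (Suc i) (add_tuple n (shift_tuple n padded (Suc i) (Suc s)) B)"
proof (rule csrr_rounds.round[OF assms(1)])
  have sub: "B a \<subseteq> set (take (i * n) padded)" for a
    using rounds_subset[OF assms(1)] assms(2) by simp
  note viol = violations_add_tuple[OF E_finite E_card pad(3) assms(2) sub]
  show "\<forall>t\<in>{1..n}. violations n E (add_tuple n (shift_tuple n padded (Suc i) (Suc s)) B) \<le>
      violations n E (add_tuple n (shift_tuple n padded (Suc i) t) B)"
  proof
    fix t assume "t \<in> {1..n}"
    then have "t - 1 < n" by auto
    then show "violations n E (add_tuple n (shift_tuple n padded (Suc i) (Suc s)) B) \<le>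
        violations n E (add_tuple n (shift_tuple n padded (Suc i) t) B)"
      unfolding viol using assms(4) by simp
  qed
qed (use assms(3) in simp)

text \<open>After the walk the counters below \<open>n\<close> are the numbers of new violations, so
  the shift found by \<open>argmin_loop\<close> is one that the algorithm may choose.\<close>

lemma runs_round_body:
  assumes "round_state i \<sigma>" "i * n < m"
  shows "runs w round_body \<sigma> (80 * length (late_edges \<sigma> (length es) i) + 100 * n + 100) (round_state (Suc i))"
proof -
  let ?ls = "late_edges \<sigma> (length es) i"
  let ?N = "\<lambda>s. length (filter (\<lambda>e. bad_shift \<sigma> e = s) ?ls)"
  let ?P = "\<lambda>\<tau> :: state. reg \<tau> rN = n \<and> reg \<tau> rM = m"
  let ?S = "\<lambda>i \<tau> :: state. ?P \<tau> \<and> reg \<tau> rRow = i \<and> reg \<tau> rStart = i * n"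
  let ?A = "\<lambda>\<tau> :: state. \<forall>r. r \<noteq> aCnt \<longrightarrow> arr \<tau> r = arr \<sigma> r"
  let ?Z = "\<lambda>\<tau> :: state. \<forall>x<n. arr \<tau> aCnt x = 0"
  have \<sigma>: "ready \<sigma>" "?S i \<sigma>" "chain (arr \<sigma> aNext) (arr \<sigma> aHead i) ?ls" "?Z \<sigma>"
    using assms(1) by (auto simp: round_state_def ready_def)
  obtain B where B: "csrr_rounds n E padded i B" "tracks i B (arr \<sigma> aOwner)"
    using assms(1) by (auto simp: round_state_def)
  have len: "Suc i * n \<le> length padded" using length_padded assms(2) by blast
  then have sub: "B a \<subseteq> set (take (i * n) padded)" for a
    using rounds_subset[OF B(1)] by simp
  have N: "card (new_violations n E padded i B s) = ?N s" if "s < n" for s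
    using card_new_violations[OF \<sigma>(1) B(2) sub len that] .
  let ?min = "\<lambda>\<tau> :: state. reg \<tau> rShift < n \<and> (\<forall>x<n. ?N (reg \<tau> rShift) \<le> ?N x)"

  let ?c1 = "Assign rK (Read aHead (Reg rRow))"
  let ?c3 = "Assign rShift (Num 0) ;; Assign rT (Read aCnt (Num 0)) ;; Assign rK (Num 0)"
  let ?c5 = "Assign rK (Reg rStart) ;; Assign rStart (Add (Reg rStart) (Reg rN)) ;; incr rRow"
  let ?Q1 = "\<lambda>\<tau> :: state. ?S i \<tau> \<and> arr \<tau> = arr \<sigma> \<and> reg \<tau> rK = arr \<sigma> aHead i"
  let ?Q2 = "\<lambda>\<tau> :: state. ?S i \<tau> \<and> ?A \<tau> \<and> (\<forall>s<n. arr \<tau> aCnt s = ?N s)"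
  let ?Q3 = "\<lambda>\<tau> :: state. ?Q2 \<tau> \<and> reg \<tau> rK = 0 \<and> reg \<tau> rShift = 0 \<and> reg \<tau> rT = arr \<tau> aCnt 0"
  let ?Q4 = "\<lambda>\<tau> :: state. ?S i \<tau> \<and> ?A \<tau> \<and> ?Z \<tau> \<and> ?min \<tau>"
  let ?Q5 = "\<lambda>\<tau> :: state. ?S (Suc i) \<tau> \<and> ?A \<tau> \<and> ?Z \<tau> \<and> ?min \<tau> \<and> reg \<tau> rK = i * n"

  have 1: "runs w ?c1 \<sigma> 3 ?Q1"
    by (rule runs_loop_free) (use \<sigma> in auto)
  have 2: "runs w walk_loop \<tau> (80 * length ?ls + 10) ?Q2" if Q: "?Q1 \<tau>" for \<tau>
  proof -
    have "chain (arr \<tau> aNext) (reg \<tau> rK) ?ls" using Q \<sigma>(3) by simp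
    moreover have "bad_shift \<tau> e = bad_shift \<sigma> e" for e
    proof -
      have eq: "reg \<tau> rN = reg \<sigma> rN" "arr \<tau> = arr \<sigma>" using Q \<sigma>(2) by auto
      show ?thesis unfolding bad_shift_def eq ..
    qed
    ultimately have "runs w walk_loop \<tau> (80 * length ?ls + 10)
        (\<lambda>\<upsilon>. \<forall>s. arr \<upsilon> aCnt s = arr \<sigma> aCnt s + ?N s)"
      using runs_walk_loop[of \<tau> ?ls w] Q by simp
    from runs_framed[OF this] show ?thesis
      by (rule runs_weaken) (use Q \<sigma>(4) in \<open>auto simp: framed_def main_loop_defs\<close>)
  qed
  have 3: "runs w ?c3 \<tau> 10 ?Q3" if "?Q2 \<tau>" for \<tau>
    by (rule runs_loop_free) (use that in auto)
  have 4: "runs w argmin_loop \<tau> (40 * n + 10) ?Q4" if Q: "?Q3 \<tau>" for \<tau>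
  proof -
    have "runs w argmin_loop \<tau> (40 * n + 10)
      (\<lambda>\<upsilon>. reg \<upsilon> rShift < n \<and> (\<forall>x<n. arr \<tau> aCnt (reg \<upsilon> rShift) \<le> arr \<tau> aCnt x) \<and> ?Z \<upsilon>)"
      using Q n by (intro runs_argmin_loop) auto
    from runs_framed[OF this] show ?thesis
      by (rule runs_weaken) (use Q in \<open>auto simp: framed_def main_loop_defs\<close>)
  qed
  have 5: "runs w ?c5 \<tau> 20 ?Q5" if "?Q4 \<tau>" for \<tau>
    by (rule runs_loop_free) (use that in auto)
  have 6: "runs w assign_loop \<tau> (50 * n + 20) (round_state (Suc i))" if Q: "?Q5 \<tau>" for \<tau>
  proof -
    let ?s = "reg \<tau> rShift"
    have ord: "arr \<tau> aOrd k = L ! k" if "k < m" for k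
      using Q \<sigma>(1) that by (simp add: ready_def)
    have inj: "inj_on (arr \<tau> aOrd) {..<m}"
      by (auto simp: inj_on_def ord L_inj)
    let ?O = "\<lambda>\<upsilon> :: state. (\<forall>k. i * n \<le> k \<and> k < Suc i * n \<and> k < m \<longrightarrow> arr \<upsilon> aOwner (arr \<tau> aOrd k) =
        (let t = Suc (arr \<tau> aCol (arr \<tau> aOrd k)) in (if ?s < t then t else t + n) - ?s)) \<and>
      (\<forall>k<i * n. k < m \<longrightarrow> arr \<upsilon> aOwner (arr \<tau> aOrd k) = arr \<tau> aOwner (arr \<tau> aOrd k))"
    have "runs w assign_loop \<tau> (50 * (Suc i * n - i * n) + 20) ?O"
      using Q inj by (intro runs_assign_loop) auto
    from runs_framed[OF this] show ?thesis
    proof (rule runs_weaken)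
      fix \<upsilon> assume u: "?O \<upsilon> \<and> framed assign_loop \<tau> \<upsilon>"
      then have arr: "arr \<upsilon> r = arr \<sigma> r" if "r \<noteq> aOwner" "r \<noteq> aCnt" for r
        using Q that by (auto simp: framed_def main_loop_defs)
      have regs: "?S (Suc i) \<upsilon>" and cnt: "?Z \<upsilon>"
        using Q u by (auto simp: framed_def main_loop_defs)
      have own: "arr \<tau> aOwner = arr \<sigma> aOwner" "arr \<tau> aCol = arr \<sigma> aCol" using Q by auto
      have "ready \<upsilon>" using \<sigma>(1) regs arr by (simp add: ready_def)
      moreover have "late_edges \<upsilon> (length es) r = late_edges \<sigma> (length es) r" for r
        using arr by (simp add: late_edges_def)
      moreover have "csrr_rounds n E padded (Suc i) (add_tuple n (shift_tuple n padded (Suc i) (Suc ?s)) B)"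
        using Q N by (intro csrr_round_min[OF B(1) len]) auto
      moreover have "tracks (Suc i) (add_tuple n (shift_tuple n padded (Suc i) (Suc ?s)) B) (arr \<upsilon> aOwner)"
      proof (rule tracks_step[OF B(2) len])
        show "?s < n" using Q by simp
        show "arr \<upsilon> aOwner (L ! k) = arr \<sigma> aOwner (L ! k)" if "k < m" "k < i * n" for k
          using u that ord own by auto
        show "arr \<upsilon> aOwner (L ! k) =
            (if ?s < Suc (k mod n) then Suc (k mod n) else Suc (k mod n) + n) - ?s"
          if "k < m" "i * n \<le> k" "k < Suc i * n" for k
        proof -
          have "arr \<upsilon> aOwner (arr \<tau> aOrd k) =
              (let t = Suc (arr \<tau> aCol (arr \<tau> aOrd k)) in (if ?s < t then t else t + n) - ?s)"
            using u that by blast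
          moreover have "arr \<sigma> aCol (L ! k) = k mod n" using \<sigma>(1) that by (simp add: ready_def)
          ultimately show ?thesis unfolding ord[OF that(1)] own Let_def by simp
        qed
      qed
      ultimately show "round_state (Suc i) \<upsilon>"
        using regs cnt arr assms(1) unfolding round_state_def by auto
    qed simp
  qed
  have 56: "runs w (?c5 ;; assign_loop) \<tau> (50 * n + 41) (round_state (Suc i))" if "?Q4 \<tau>" for \<tau>
    using 5[OF that] 6 by (rule runs_Seq) simp_all
  have 456: "runs w (argmin_loop ;; ?c5 ;; assign_loop) \<tau> (90 * n + 52) (round_state (Suc i))"
    if "?Q3 \<tau>" for \<tau>
    using 4[OF that] 56 by (rule runs_Seq) simp_all
  have 3456: "runs w (?c3 ;; argmin_loop ;; ?c5 ;; assign_loop) \<tau> (90 * n + 63) (round_state (Suc i))"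
    if "?Q2 \<tau>" for \<tau>
    using 3[OF that] 456 by (rule runs_Seq) simp_all
  have 23456: "runs w (walk_loop ;; ?c3 ;; argmin_loop ;; ?c5 ;; assign_loop) \<tau>
      (80 * length ?ls + 90 * n + 74) (round_state (Suc i))" if "?Q1 \<tau>" for \<tau>
    using 2[OF that] 3456 by (rule runs_Seq) simp_all
  show ?thesis
    unfolding round_body_def using 1 23456 by (rule runs_Seq) simp_all
qed

lemma runs_round_loop:
  assumes "1 \<le> m" "round_state 1 \<sigma>"
  shows "runs w round_loop \<sigma> (300 * m + 80 * length es + 10)
    (\<lambda>\<tau>. round_state (padded_size n m div n) \<tau>)"
proof -
  \<comment> \<open>The edges still to be paid for: those whose later end lies in row
    \<open>i\<close> or beyond. Each round uses up its own list.\<close>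
  define late where "late i = length (filter (\<lambda>e. i \<le> max (arr \<sigma> aRow (arr \<sigma> aFst e)) (arr \<sigma> aRow (arr \<sigma> aSnd e)))
    (rev [0..<length es]))" for i
  have late_Suc: "length (late_edges \<sigma> (length es) i) + late (Suc i) \<le> late i" for i
    unfolding late_def late_edges_def by (rule length_filter_disjoint_le) auto
  \<comment> \<open>The term \<open>m + n\<close> rather than \<open>m\<close> keeps the subtraction
    exact when the last row reaches beyond \<open>m\<close>. Since the loop starts at row 1, the
    initial value is still \<open>300 * m\<close> plus the edges, with no term in
    \<open>n\<close>.\<close>
  let ?I = "\<lambda>p \<tau> :: state. \<exists>i. round_state i \<tau> \<and> 1 \<le> i \<and> (i - 1) * n < m \<and>
    p = 300 * (m + n - i * n) + 80 * late i"
  have "runs w round_loop \<sigma> (300 * m + 80 * length es + 10)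
    (\<lambda>\<tau>. (\<exists>q. ?I q \<tau>) \<and> \<not> bval w (Less (Reg rStart) (Reg rM)) \<tau> \<and> framed round_body \<sigma> \<tau>)"
    unfolding round_loop_def
  proof (rule runs_While[where p = "300 * (m + n - 1 * n) + 80 * late 1"])
    show "?I (300 * (m + n - 1 * n) + 80 * late 1) \<sigma>"
      using assms by (intro exI[of _ 1]) simp
    have "late 1 \<le> length es" unfolding late_def by (metis length_filter_le length_rev length_upt minus_nat.diff_0)
    then show "300 * (m + n - 1 * n) + 80 * late 1 + bcost (Less (Reg rStart) (Reg rM)) + 1
        \<le> 300 * m + 80 * length es + 10" by simp
    fix p \<tau>
    assume I: "?I p \<tau>" and fr: "framed round_body \<sigma> \<tau>" and less: "bval w (Less (Reg rStart) (Reg rM)) \<tau>"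
    obtain i where i: "round_state i \<tau>" "1 \<le> i" "p = 300 * (m + n - i * n) + 80 * late i"
      using I by blast
    then have im: "i * n < m" using less by (simp add: round_state_def ready_def)
    have "late_edges \<tau> (length es) i = late_edges \<sigma> (length es) i"
      using fr by (simp add: late_edges_def framed_def main_loop_defs)
    then have "runs w round_body \<tau> (80 * length (late_edges \<sigma> (length es) i) + 100 * n + 100)
        (round_state (Suc i))"
      using runs_round_body[OF i(1) im] by simp
    then show "\<exists>B. runs w round_body \<tau> B
      (\<lambda>\<upsilon>. \<exists>q. ?I q \<upsilon> \<and> q + B + bcost (Less (Reg rStart) (Reg rM)) + 1 \<le> p)"
    proof (rule runs_exI)
      fix \<upsilon> assume u: "round_state (Suc i) \<upsilon>"
      let ?q = "300 * (m + n - Suc i * n) + 80 * late (Suc i)"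
      \<comment> \<open>The drop of \<open>300 * n\<close> pays for \<open>100 * n + 104\<close>
        because \<open>1 \<le> n\<close>.\<close>
      have arith: "300 * d + 80 * b + (80 * a + 100 * n + 100) + 4 \<le> 300 * (d + n) + 80 * c"
        if "a + b \<le> c" for a b c d :: nat
        using that n by simp
      define d where "d = m + n - Suc i * n"
      then have d: "m + n - i * n = d + n" "m + n - Suc i * n = d" using im by simp_all
      have "?q + (80 * length (late_edges \<sigma> (length es) i) + 100 * n + 100) + 4 \<le> p"
        unfolding i(3) d using arith[OF late_Suc] .
      moreover have "?I ?q \<upsilon>" using u im by (intro exI[of _ "Suc i"]) simp
      ultimately show "\<exists>q. ?I q \<upsilon> \<and> q + (80 * length (late_edges \<sigma> (length es) i) + 100 * n + 100) +
          bcost (Less (Reg rStart) (Reg rM)) + 1 \<le> p"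
        by (intro exI[of _ ?q]) simp
    qed
  qed
  then show ?thesis
  proof (rule runs_weaken)
    fix \<tau>
    assume *: "(\<exists>q. ?I q \<tau>) \<and> \<not> bval w (Less (Reg rStart) (Reg rM)) \<tau> \<and> framed round_body \<sigma> \<tau>"
    then obtain i where i: "round_state i \<tau>" "1 \<le> i" "(i - 1) * n < m" by blast
    moreover have "m \<le> i * n" using * i by (simp add: round_state_def ready_def)
    \<comment> \<open>The last round began before \<open>m\<close>, so the loop stops at the one
      multiple of \<open>n\<close> that is the padded size.\<close>
    moreover have "i * n < m + n"
    proof -
      have "i * n = (i - 1) * n + n" using i(2) by (cases i) simp_all
      then show ?thesis using i(3) by simp
    qed
    ultimately have "padded_size n m = i * n"
      using n by (intro padded_size_unique) auto
    then show "round_state (padded_size n m div n) \<tau>" using i(1) n by simp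
  qed simp
qed

end

section \<open>Composition of the phases\<close>

definition sort_phase :: com where
  "sort_phase = init_loop ;; Assign rWidth (Num 1) ;; sort_loop"

definition round_phase :: com where
  "round_phase =
     Assign rK (Num 0) ;; place_loop ;; Assign rK (Num 0) ;; link_loop ;;
     (Assign rStart (Reg rN) ;; Assign rRow (Num 1)) ;; round_loop"

lemma runs_sort_phase:
  assumes "reg \<sigma> rK = 0" "reg \<sigma> rM = m" "m \<le> 2 ^ h"
  shows "runs (\<lambda>g. v {g}) sort_phase \<sigma> ((150 * m + 60) * h + 20 * m + 40)
    (\<lambda>\<tau>. (\<exists>L. sorted_goods m v L \<and> (\<forall>k<m. arr \<tau> aOrd k = L ! k)) \<and> framed sort_phase \<sigma> \<tau>)"
proof -
  let ?w = "\<lambda>g. v {g}"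
  let ?P1 = "\<lambda>\<tau> :: state. (\<forall>k<m. arr \<tau> aOrd k = Suc k) \<and> reg \<tau> rM = m"
  let ?P2 = "\<lambda>\<tau> :: state. ?P1 \<tau> \<and> reg \<tau> rWidth = 1"
  let ?Q = "\<lambda>\<tau> :: state. \<exists>L. sorted_goods m v L \<and> (\<forall>k<m. arr \<tau> aOrd k = L ! k)"
  have "runs ?w init_loop \<sigma> (20 * m + 20) (\<lambda>\<tau>. \<forall>k<m. arr \<tau> aOrd k = Suc k)"
    using runs_init_loop[OF assms(1)] assms(2) by simp
  from runs_framed[OF this] have 1: "runs ?w init_loop \<sigma> (20 * m + 20) ?P1"
    by (rule runs_weaken) (use assms in \<open>auto simp: framed_def init_loop_def init_body_def\<close>)
  have 2: "runs ?w (Assign rWidth (Num 1)) \<tau> 2 ?P2" if "?P1 \<tau>" for \<tau>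
    by (rule runs_loop_free) (use that in auto)
  have 3: "runs ?w sort_loop \<tau> ((150 * m + 60) * h + 10) ?Q" if P: "?P2 \<tau>" for \<tau>
  proof -
    have "runs ?w sort_loop \<tau> ((150 * m + 60) * h + 10)
      (\<lambda>\<upsilon>. arr \<upsilon> aOrd ` {..<m} = arr \<tau> aOrd ` {..<m} \<and> decreasing_on ?w (arr \<upsilon> aOrd) 0 m)"
      using P assms(3) by (intro runs_sort_loop) auto
    then show ?thesis
    proof (rule runs_weaken)
      fix \<upsilon> :: state
      assume u: "arr \<upsilon> aOrd ` {..<m} = arr \<tau> aOrd ` {..<m} \<and> decreasing_on ?w (arr \<upsilon> aOrd) 0 m"
      have "arr \<tau> aOrd ` {..<m} = Suc ` {..<m}" using P by (intro image_cong) auto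
      also have "\<dots> = goods m" by (simp add: goods_def image_Suc_lessThan)
      finally have im: "arr \<upsilon> aOrd ` {..<m} = goods m" using u by simp
      \<comment> \<open>The sort is known only to preserve the set of entries. That set has as many
        elements as there are positions, so no entry occurs twice.\<close>
      then have "inj_on (arr \<upsilon> aOrd) {..<m}"
        by (intro eq_card_imp_inj_on) (simp_all add: goods_def)
      then have "distinct (map (arr \<upsilon> aOrd) [0..<m])"
        by (simp add: distinct_map lessThan_atLeast0)
      moreover have "sorted_wrt (\<lambda>g h. v {h} \<le> v {g}) (map (arr \<upsilon> aOrd) [0..<m])"
        using u by (auto simp: sorted_wrt_iff_nth_less decreasing_on_def)
      ultimately have "sorted_goods m v (map (arr \<upsilon> aOrd) [0..<m])"
        using im by (simp add: sorted_goods_def lessThan_atLeast0)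
      then show "?Q \<upsilon>" by (intro exI[of _ "map (arr \<upsilon> aOrd) [0..<m]"]) simp
    qed simp
  qed
  have 23: "runs ?w (Assign rWidth (Num 1) ;; sort_loop) \<tau> ((150 * m + 60) * h + 13) ?Q"
    if "?P1 \<tau>" for \<tau>
    using 2[OF that] 3 by (rule runs_Seq) simp_all
  have "runs ?w sort_phase \<sigma> ((150 * m + 60) * h + 20 * m + 40) ?Q"
    unfolding sort_phase_def using 1 23 by (rule runs_Seq) simp_all
  from runs_framed[OF this] show ?thesis .
qed

context csrr_input
begin

text \<open>All bundles are empty before the first round, so every shift adds no violation and shift
  0, used by the placement, is a minimum.\<close>

lemma round_state_1:
  assumes "1 \<le> m" "ready \<sigma>" "reg \<sigma> rRow = 1" "reg \<sigma> rStart = n"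
    and "\<And>r. chain (arr \<sigma> aNext) (arr \<sigma> aHead r) (late_edges \<sigma> (length es) r)"
    and "\<And>x. arr \<sigma> aCnt x = 0" "\<And>k. k < m \<Longrightarrow> arr \<sigma> aOwner (L ! k) = Suc (k mod n)"
  shows "round_state 1 \<sigma>"
proof -
  let ?B = "add_tuple n (shift_tuple n padded (Suc 0) (Suc 0)) (\<lambda>_. {})"
  have len: "Suc 0 * n \<le> length padded" using length_padded[of 0] assms(1) by simp
  have "csrr_rounds n E padded (Suc 0) ?B"
    using csrr_rounds.start len by (rule csrr_round_min) (use n in \<open>auto simp: new_violations_def\<close>)
  moreover have "tracks (Suc 0) ?B (arr \<sigma> aOwner)"
    by (rule tracks_step[where own = "arr \<sigma> aOwner", OF _ len])
      (use n assms(7) in \<open>auto simp: tracks_def\<close>)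
  ultimately show ?thesis using assms unfolding round_state_def by auto
qed

lemma round_state_output:
  assumes "round_state (padded_size n m div n) \<sigma>"
  shows "cyclic_shift_rr n m v E (output_alloc m \<sigma>)"
proof -
  let ?R = "padded_size n m div n"
  note p = padded_size_properties[OF n, of m]
  obtain B where B: "csrr_rounds n E padded ?R B" "tracks ?R B (arr \<sigma> aOwner)"
    using assms by (auto simp: round_state_def)
  have "B a \<inter> goods m = output_alloc m \<sigma> a" for a
  proof (intro set_eqI)
    fix g
    show "g \<in> B a \<inter> goods m \<longleftrightarrow> g \<in> output_alloc m \<sigma> a"
    proof (cases "g \<in> goods m")
      case True
      then obtain k where k: "k < m" "g = L ! k" by (rule goods_nth)
      then have "k < ?R * n" using p by simp
      then show ?thesis using B(2) k True by (simp add: tracks_def output_alloc_def)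
    qed (simp add: output_alloc_def)
  qed
  then show ?thesis unfolding cyclic_shift_rr_def using L B(1) by metis
qed

lemma runs_round_phase:
  assumes "reg \<sigma> rN = n" "reg \<sigma> rM = m" "reg \<sigma> rE = length es" "reg \<sigma> rRow = 0" "reg \<sigma> rCol = 0"
    and "\<And>e. e < length es \<Longrightarrow> arr \<sigma> aFst e = fst (es ! e)"
    and "\<And>e. e < length es \<Longrightarrow> arr \<sigma> aSnd e = snd (es ! e)"
    and "\<And>k. k < m \<Longrightarrow> arr \<sigma> aOrd k = L ! k"
    and "\<And>x. arr \<sigma> aHead x = 0" "\<And>x. arr \<sigma> aCnt x = 0"
  shows "runs w round_phase \<sigma> (350 * m + 150 * length es + 60)
    (\<lambda>\<tau>. cyclic_shift_rr n m v E (output_alloc m \<tau>))"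
proof -
  let ?l = "length es"
  let ?Q = "\<lambda>\<tau>. cyclic_shift_rr n m v E (output_alloc m \<tau>)"
  let ?P1 = "\<lambda>\<tau> :: state. reg \<tau> rK = 0 \<and> (\<forall>x. x \<noteq> rK \<longrightarrow> reg \<tau> x = reg \<sigma> x) \<and> arr \<tau> = arr \<sigma>"
  let ?P2 = "\<lambda>\<tau> :: state. ready \<tau> \<and> reg \<tau> rE = ?l \<and> (\<forall>x. arr \<tau> aHead x = 0) \<and> (\<forall>x. arr \<tau> aCnt x = 0) \<and>
    (\<forall>k<m. arr \<tau> aOwner (L ! k) = Suc (k mod n))"
  let ?P3 = "\<lambda>\<tau> :: state. ?P2 \<tau> \<and> reg \<tau> rK = 0"
  let ?P4 = "\<lambda>\<tau> :: state. ready \<tau> \<and> (\<forall>x. arr \<tau> aCnt x = 0) \<and>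
    (\<forall>k<m. arr \<tau> aOwner (L ! k) = Suc (k mod n)) \<and>
    (\<forall>r. chain (arr \<tau> aNext) (arr \<tau> aHead r) (late_edges \<tau> ?l r))"
  let ?P5 = "\<lambda>\<tau> :: state. ?P4 \<tau> \<and> reg \<tau> rRow = 1 \<and> reg \<tau> rStart = n"
  let ?c5 = "Assign rStart (Reg rN) ;; Assign rRow (Num 1)"
  have 1: "runs w (Assign rK (Num 0)) \<sigma> 2 ?P1"
    by (rule runs_loop_free) auto
  have 2: "runs w place_loop \<tau> (50 * m + 10) ?P2" if P: "?P1 \<tau>" for \<tau>
  proof -
    have inj: "inj_on (arr \<tau> aOrd) {..<m}"
      using P assms(8) by (auto simp: inj_on_def L_inj)
    let ?O = "\<lambda>\<upsilon> :: state. \<forall>k<m. arr \<upsilon> aRow (arr \<tau> aOrd k) = k div n \<and>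
      arr \<upsilon> aCol (arr \<tau> aOrd k) = k mod n \<and> arr \<upsilon> aOwner (arr \<tau> aOrd k) = Suc (k mod n)"
    have "runs w place_loop \<tau> (50 * m + 10) ?O"
      using P assms n inj by (intro runs_place_loop) auto
    from runs_framed[OF this] show ?thesis
      by (rule runs_weaken)
        (use P assms in \<open>auto simp: framed_def main_loop_defs ready_def\<close>)
  qed
  have 3: "runs w (Assign rK (Num 0)) \<tau> 2 ?P3" if "?P2 \<tau>" for \<tau>
    by (rule runs_loop_free) (use that in \<open>auto simp: ready_def\<close>)
  have 4: "runs w link_loop \<tau> (70 * ?l + 10) ?P4" if P: "?P3 \<tau>" for \<tau>
  proof -
    have "runs w link_loop \<tau> (70 * ?l + 10)
      (\<lambda>\<upsilon>. \<forall>r. chain (arr \<upsilon> aNext) (arr \<upsilon> aHead r) (late_edges \<tau> ?l r))"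
      using P by (intro runs_link_loop) auto
    from runs_framed[OF this] show ?thesis
      by (rule runs_weaken)
        (use P in \<open>auto simp: framed_def main_loop_defs ready_def late_edges_def\<close>)
  qed
  have 5: "runs w ?c5 \<tau> 10 ?P5" if "?P4 \<tau>" for \<tau>
    by (rule runs_loop_free) (use that in \<open>auto simp: ready_def late_edges_def\<close>)
  have 6: "runs w round_loop \<tau> (300 * m + 80 * ?l + 10) ?Q" if P: "?P5 \<tau>" for \<tau>
  proof (cases "1 \<le> m")
    case True
    have "round_state 1 \<tau>" using P by (intro round_state_1[OF True]) auto
    from runs_round_loop[OF True this] show ?thesis
      by (rule runs_weaken) (auto intro: round_state_output)
  next
    case False
    \<comment> \<open>Without goods the algorithm makes no round, so \<open>round_state 1\<close> is
      not the state to aim at. The loop is not entered, and any memory is read as the empty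
      allocation.\<close>
    have m: "m = 0" using False by simp
    have "padded_size n 0 = 0" by (rule padded_size_unique) (use n in auto)
    then have "cyclic_shift_rr n 0 v E (\<lambda>_. {})"
      using L m csrr_rounds.start unfolding cyclic_shift_rr_def
      by (intro exI[of _ L] exI[of _ "\<lambda>_. {}"]) simp
    then have Q: "?Q \<upsilon>" for \<upsilon>
      by (simp add: m output_alloc_def goods_def)
    have "runs w round_loop \<tau> (300 * m + 80 * ?l + 10)
      (\<lambda>\<upsilon>. (\<exists>q. q = (0 :: nat) \<and> reg \<upsilon> rM = 0) \<and> \<not> bval w (Less (Reg rStart) (Reg rM)) \<upsilon> \<and>
        framed round_body \<tau> \<upsilon>)"
      unfolding round_loop_def
      by (rule runs_While[where p = 0]) (use P False in \<open>auto simp: ready_def\<close>)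
    then show ?thesis by (rule runs_weaken) (simp_all add: Q)
  qed
  have 56: "runs w (?c5 ;; round_loop) \<tau> (300 * m + 80 * ?l + 21) ?Q" if "?P4 \<tau>" for \<tau>
    using 5[OF that] 6 by (rule runs_Seq) simp_all
  have 456: "runs w (link_loop ;; ?c5 ;; round_loop) \<tau> (300 * m + 150 * ?l + 32) ?Q" if "?P3 \<tau>" for \<tau>
    using 4[OF that] 56 by (rule runs_Seq) simp_all
  have 3456: "runs w (Assign rK (Num 0) ;; link_loop ;; ?c5 ;; round_loop) \<tau> (300 * m + 150 * ?l + 35) ?Q"
    if "?P2 \<tau>" for \<tau>
    using 3[OF that] 456 by (rule runs_Seq) simp_all
  have 23456: "runs w (place_loop ;; Assign rK (Num 0) ;; link_loop ;; ?c5 ;; round_loop) \<tau>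
      (350 * m + 150 * ?l + 46) ?Q" if "?P1 \<tau>" for \<tau>
    using 2[OF that] 3456 by (rule runs_Seq) simp_all
  show ?thesis
    unfolding round_phase_def using 1 23456 by (rule runs_Seq) simp_all
qed

end

section \<open>The whole program and its time bound\<close>

definition cyclic_shift_program :: com where
  "cyclic_shift_program = sort_phase ;; round_phase"

lemma cyclic_shift_program_correct:
  assumes "1 \<le> n" "simple_graph_on (goods m) E" "edge_list E es" "m \<le> 2 ^ h"
  shows "runs (\<lambda>g. v {g}) cyclic_shift_program (input_state n m es)
    ((150 * m + 60) * h + 370 * m + 150 * card E + 101)
    (\<lambda>\<tau>. cyclic_shift_rr n m v E (output_alloc m \<tau>))"
proof -
  let ?\<sigma> = "input_state n m es"
  have "runs (\<lambda>g. v {g}) sort_phase ?\<sigma> ((150 * m + 60) * h + 20 * m + 40)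
    (\<lambda>\<tau>. (\<exists>L. sorted_goods m v L \<and> (\<forall>k<m. arr \<tau> aOrd k = L ! k)) \<and> framed sort_phase ?\<sigma> \<tau>)"
    by (rule runs_sort_phase) (use assms in \<open>simp_all add: input_state_def\<close>)
  then show ?thesis
    unfolding cyclic_shift_program_def
  proof (rule runs_Seq)
    fix \<tau>
    assume *: "(\<exists>L. sorted_goods m v L \<and> (\<forall>k<m. arr \<tau> aOrd k = L ! k)) \<and> framed sort_phase ?\<sigma> \<tau>"
    then obtain L where sorted: "sorted_goods m v L" and ord: "\<forall>k<m. arr \<tau> aOrd k = L ! k" by blast
    have framed: "framed sort_phase ?\<sigma> \<tau>" using * by blast
    interpret csrr_input n m v E es L
      by unfold_locales (use assms sorted in auto)
    show "runs (\<lambda>g. v {g}) round_phase \<tau> (350 * m + 150 * length es + 60)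
      (\<lambda>\<tau>. cyclic_shift_rr n m v E (output_alloc m \<tau>))"
      by (rule runs_round_phase)
        (use framed ord in \<open>auto simp: framed_def input_state_def sort_phase_def loop_defs init_loop_def init_body_def\<close>)
  next
    have "length es = card E"
      using assms(3) distinct_card[of "map (\<lambda>(x, y). {x, y}) es"] by (simp add: edge_list_def)
    then show "(150 * m + 60) * h + 20 * m + 40 + (350 * m + 150 * length es + 60) + 1
        \<le> (150 * m + 60) * h + 370 * m + 150 * card E + 101" by simp
  qed
qed

text \<open>For \<open>2 \<le> m\<close> the logarithm is at least 1, which absorbs both the
  rounding up in \<open>h\<close> and the terms that are linear or constant.\<close>

lemma running_time_bound:
  assumes "2 \<le> m"
  obtains h where "m \<le> 2 ^ h"
    "real ((150 * m + 60) * h + 370 * m + 150 * e + 101) \<le> 1000 * (real m * log 2 (real m) + real e)"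
proof -
  define h where "h = nat \<lceil>log 2 (real m)\<rceil>"
  have log1: "1 \<le> log 2 (real m)" using assms by (simp add: le_log_iff)
  have "log 2 (real m) \<le> real h" by (simp add: h_def real_nat_ceiling_ge)
  then have "real m \<le> 2 powr real h" using assms by (simp add: log_le_iff)
  then have "real m \<le> real (2 ^ h)" by (simp add: powr_realpow)
  then have mh: "m \<le> 2 ^ h" by (rule of_nat_le_iff[THEN iffD1])
  have "real h \<le> log 2 (real m) + 1" using log1 by (simp add: h_def) 
  then have h: "real h \<le> 2 * log 2 (real m)" using log1 by linarith
  have m: "real m \<le> real m * log 2 (real m)"
    using log1 mult_left_mono[of 1 "log 2 (real m)" "real m"] by simp
  \<comment> \<open>Here \<open>60 \<le> 30 * m\<close>, and rounding up at most doubles the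
    logarithm.\<close>
  have "(150 * real m + 60) * real h \<le> (180 * real m) * (2 * log 2 (real m))"
    using h assms by (intro mult_mono) auto
  then have "(150 * real m + 60) * real h + 370 * real m + 101 \<le> 1000 * (real m * log 2 (real m))"
    using m log1 assms by linarith
  then have "real ((150 * m + 60) * h + 370 * m + 150 * e + 101) \<le> 1000 * (real m * log 2 (real m) + real e)"
    by simp
  with mh show ?thesis by (rule that)
qed

theorem theorem7:
  shows "(\<forall>n m V E v A.
            fd_instance n m V E \<and> identical_valuations n m V v \<and> cyclic_shift_rr n m v E A \<longrightarrow>
              allocation n m A \<and> complete_alloc n m A \<and> balanced n A \<and> EF1 n V A \<and>
              real (violations n E A) \<le> real (card E) / real n)
       \<and> (\<exists>p (C::real). \<forall>n m V E v es.
            fd_instance n m V E \<and> identical_valuations n m V v \<and> edge_list E es \<longrightarrow>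
              (\<exists>A t. computes_in p n m v es t A \<and> cyclic_shift_rr n m v E A \<and>
                 (m \<ge> 2 \<longrightarrow> real t \<le> C * (real m * log 2 (real m) + real (card E))) \<and>
                 (m < 2 \<longrightarrow> real t \<le> C)))"
proof (intro conjI allI impI, goal_cases)
  \<comment> \<open>Goals 1 to 5 are the properties of an output; goal 6 is the existence of the
    program.\<close>
  case 6
  show ?case
  proof (intro exI[of _ cyclic_shift_program] exI[of _ "1000 :: real"] allI impI)
    fix n m V E v es
    assume *: "fd_instance n m V E \<and> identical_valuations n m V v \<and> edge_list E es"
    have n: "1 \<le> n" and E: "simple_graph_on (goods m) E" using * by (auto simp: fd_instance_def)
    have runs: "\<exists>A t. computes_in cyclic_shift_program n m v es t A \<and> cyclic_shift_rr n m v E A \<and>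
        t \<le> (150 * m + 60) * h + 370 * m + 150 * card E + 101" if h: "m \<le> 2 ^ h" for h
    proof -
      obtain t \<tau> where "exec (\<lambda>g. v {g}) cyclic_shift_program (input_state n m es) t \<tau>"
        "t \<le> (150 * m + 60) * h + 370 * m + 150 * card E + 101"
        "cyclic_shift_rr n m v E (output_alloc m \<tau>)"
        using cyclic_shift_program_correct[OF n E _ h, of es v] * unfolding runs_def by blast
      then show ?thesis unfolding computes_in_def by blast
    qed
    show "\<exists>A t. computes_in cyclic_shift_program n m v es t A \<and> cyclic_shift_rr n m v E A \<and>
        (m \<ge> 2 \<longrightarrow> real t \<le> 1000 * (real m * log 2 (real m) + real (card E))) \<and>
        (m < 2 \<longrightarrow> real t \<le> 1000)"
    proof (cases "2 \<le> m")
      case True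
      then obtain h where h: "m \<le> 2 ^ h" "real ((150 * m + 60) * h + 370 * m + 150 * card E + 101) \<le>
          1000 * (real m * log 2 (real m) + real (card E))"
        by (rule running_time_bound)
      obtain A t where At: "computes_in cyclic_shift_program n m v es t A" "cyclic_shift_rr n m v E A"
        "t \<le> (150 * m + 60) * h + 370 * m + 150 * card E + 101"
        using runs[OF h(1)] by blast
      have "real t \<le> 1000 * (real m * log 2 (real m) + real (card E))"
        using of_nat_mono[OF At(3)] h(2) by (rule order.trans)
      then show ?thesis using At True by (intro exI[of _ A] exI[of _ t]) simp
    next
      case False
      \<comment> \<open>An edge needs two goods. For \<open>m < 2\<close> the cost bound is thus a
        constant, and \<open>h = 0\<close> is admissible.\<close>
      have "E = {}"
      proof (rule ccontr)
        assume "E \<noteq> {}"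
        then obtain e where "e \<subseteq> goods m" "card e = 2" using E by (auto simp: simple_graph_on_def)
        then have "2 \<le> card (goods m)" by (metis card_mono finite_atLeastAtMost goods_def)
        then show False using False by (simp add: goods_def)
      qed
      obtain A t where At: "computes_in cyclic_shift_program n m v es t A" "cyclic_shift_rr n m v E A"
        "t \<le> (150 * m + 60) * 0 + 370 * m + 150 * card E + 101"
        using runs[of 0] False by auto
      then have "real t \<le> 1000" using False \<open>E = {}\<close> by simp
      then show ?thesis using At False by (intro exI[of _ A] exI[of _ t]) simp
    qed
  qed
qed (blast dest: cyclic_shift_rr_correct)+

end
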